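(* Let $\mathscr{C}$ be the category of pairs (countably compact topological group, non-empty finite set), $\mathscr{K}$ the category of $0$-simple countably compact topological inverse semigroups with non-trivial continuous homomorphisms, and $\mathbf{B}\colon\mathscr{C}\to\mathscr{K}$ the Brandt-extension assignment, all as defined in the context. Then $\mathbf{B}$ is a full representative functor from $\mathscr{C}$ into $\mathscr{K}$. The same holds with "countably compact" replaced by "compact" throughout (for groups in $\mathscr{C}$ and for inverse semigroups in $\mathscr{K}$).
   Context: All topological spaces are Hausdorff. A topological inverse semigroup is an inverse semigroup with a topology making multiplication and inversion continuous. A homomorphism is trivial if it is constant, non-trivial otherwise. Category $\mathscr{C}$: objects are pairs $(G,I)$ with $G$ a countably compact (resp. compact) topological group and $I$ a non-empty finite set. Morphisms $(G,I)\to(G',I')$ are triples $(h,u,\varphi)$ with $h\colon G\to G'$ a continuous group homomorphism, $u\colon I\to G'$ a map, and $\varphi\colon I\to I'$ a one-to-one map. The composite of $(h,u,\varphi)\colon(G,I)\to(G',I')$ followed by $(h',u',\varphi')\colon(G',I')\to(G'',I'')$ is $(h'\circ h,\,w,\,\varphi'\circ\varphi)$ with $w(\alpha)=u'(\varphi(\alpha))\cdot h'(u(\alpha))$ for $\alpha\in I$; the identity of $(G,I)$ is $(\mathrm{Id}_G,u_0,\mathrm{Id}_I)$ with $u_0(\alpha)=1_G$ for all $\alpha$. Category $\mathscr{K}$: objects are all $0$-simple countably compact (resp. compact) topological inverse semigroups; morphisms are the non-trivial continuous homomorphisms. Functor $\mathbf{B}$: $\mathbf{B}(G,I)$ is the set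 $(I\times G\times I)\cup\{0\}$ with $(\alpha,a,\beta)(\gamma,b,\delta)=(\alpha,ab,\delta)$ if $\beta=\gamma$ and all other products equal to $0$, topologized so that $0$ is isolated and each $\{\alpha\}\times G\times\{\beta\}$ is an open subspace homeomorphic to $G$ via the middle coordinate (this is the topological Brandt $\lambda^0$-extension, $\lambda=|I|$, of $G$ with an isolated zero adjoined). On morphisms, $\mathbf{B}(h,u,\varphi)$ sends $0$ to $0$ and $(\alpha,g,\beta)$ to $(\varphi(\alpha),\,u(\alpha)h(g)u(\beta)^{-1},\,\varphi(\beta))$. A functor $\mathbf{F}\colon\mathscr{C}\to\mathscr{K}$ is full if for all objects $a,b$ of $\mathscr{C}$ every $\mathscr{K}$-morphism $\mathbf{F}a\to\mathbf{F}b$ equals $\mathbf{F}\beta$ for some $\mathscr{C}$-morphism $\beta\colon a\to b$; it is representative if every object of $\mathscr{K}$ is isomorphic to $\mathbf{F}b$ for some object $b$ of $\mathscr{C}$ (isomorphic meaning topologically isomorphic as semigroups). $0$-simple: a semigroup $S$ with zero, $S\cdot S\neq\{0\}$, whose only two-sided ideals are $\{0\}$ and $S$. *)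

theory Defs
  imports "HOL-Analysis.Analysis" "HOL-Algebra.Group"
begin

section \<open>Categories and functors\<close>

text \<open>
  Hom-sets need not be disjoint, so identities, composition and the action of a functor on morphisms
  take the objects involved as arguments: \<open>Comp C a b c g f\<close> is the composite
  of \<open>f : a \<rightarrow> b\<close> followed by \<open>g : b \<rightarrow> c\<close>.
\<close>

record ('o, 'm) cat =
  Obj  :: "'o set"
  Hom  :: "'o \<Rightarrow> 'o \<Rightarrow> 'm set"
  Idn  :: "'o \<Rightarrow> 'm"
  Comp :: "'o \<Rightarrow> 'o \<Rightarrow> 'o \<Rightarrow> 'm \<Rightarrow> 'm \<Rightarrow> 'm"

definition is_category :: "('o, 'm) cat \<Rightarrow> bool" where
  "is_category C \<longleftrightarrow>
     (\<forall>a \<in> Obj C. Idn C a \<in> Hom C a a) \<and>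
     (\<forall>a \<in> Obj C. \<forall>b \<in> Obj C. \<forall>c \<in> Obj C. \<forall>f \<in> Hom C a b. \<forall>g \<in> Hom C b c.
        Comp C a b c g f \<in> Hom C a c) \<and>
     (\<forall>a \<in> Obj C. \<forall>b \<in> Obj C. \<forall>f \<in> Hom C a b.
        Comp C a a b f (Idn C a) = f \<and> Comp C a b b (Idn C b) f = f) \<and>
     (\<forall>a \<in> Obj C. \<forall>b \<in> Obj C. \<forall>c \<in> Obj C. \<forall>d \<in> Obj C.
        \<forall>f \<in> Hom C a b. \<forall>g \<in> Hom C b c. \<forall>h \<in> Hom C c d.
        Comp C a b d (Comp C b c d h g) f = Comp C a c d h (Comp C a b c g f))"

definition is_functor ::
  "('o, 'm) cat \<Rightarrow> ('p, 'n) cat \<Rightarrow> ('o \<Rightarrow> 'p) \<Rightarrow> ('o \<Rightarrow> 'o \<Rightarrow> 'm \<Rightarrow> 'n) \<Rightarrow> bool" where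
  "is_functor C D Fo Fm \<longleftrightarrow>
     is_category C \<and> is_category D \<and>
     (\<forall>a \<in> Obj C. Fo a \<in> Obj D) \<and>
     (\<forall>a \<in> Obj C. \<forall>b \<in> Obj C. \<forall>f \<in> Hom C a b. Fm a b f \<in> Hom D (Fo a) (Fo b)) \<and>
     (\<forall>a \<in> Obj C. Fm a a (Idn C a) = Idn D (Fo a)) \<and>
     (\<forall>a \<in> Obj C. \<forall>b \<in> Obj C. \<forall>c \<in> Obj C. \<forall>f \<in> Hom C a b. \<forall>g \<in> Hom C b c.
        Fm a c (Comp C a b c g f) = Comp D (Fo a) (Fo b) (Fo c) (Fm b c g) (Fm a b f))"

definition is_full ::
  "('o, 'm) cat \<Rightarrow> ('p, 'n) cat \<Rightarrow> ('o \<Rightarrow> 'p) \<Rightarrow> ('o \<Rightarrow> 'o \<Rightarrow> 'm \<Rightarrow> 'n) \<Rightarrow> bool" where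
  "is_full C D Fo Fm \<longleftrightarrow>
     (\<forall>a \<in> Obj C. \<forall>b \<in> Obj C. \<forall>g \<in> Hom D (Fo a) (Fo b). \<exists>f \<in> Hom C a b. g = Fm a b f)"

text \<open>The notion of isomorphism between objects of the target is the parameter \<open>R\<close>.\<close>

definition is_representative ::
  "('p \<Rightarrow> 'p \<Rightarrow> bool) \<Rightarrow> ('o, 'm) cat \<Rightarrow> ('p, 'n) cat \<Rightarrow> ('o \<Rightarrow> 'p) \<Rightarrow> bool" where
  "is_representative R C D Fo \<longleftrightarrow> (\<forall>d \<in> Obj D. \<exists>c \<in> Obj C. R d (Fo c))"


section \<open>Topological groups and topological inverse semigroups\<close>

definition countably_compact_space :: "'a topology \<Rightarrow> bool" where
  "countably_compact_space X \<longleftrightarrow>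
     (\<forall>\<U>. countable \<U> \<and> (\<forall>U \<in> \<U>. openin X U) \<and> topspace X \<subseteq> \<Union>\<U> \<longrightarrow>
        (\<exists>\<F>. finite \<F> \<and> \<F> \<subseteq> \<U> \<and> topspace X \<subseteq> \<Union>\<F>))"

record 'a top_group = "'a monoid" +
  gtop :: "'a topology"

definition is_top_group :: "'a top_group \<Rightarrow> bool" where
  "is_top_group G \<longleftrightarrow>
     group G \<and> topspace (gtop G) = carrier G \<and> Hausdorff_space (gtop G) \<and>
     continuous_map (prod_topology (gtop G) (gtop G)) (gtop G) (\<lambda>(x, y). x \<otimes>\<^bsub>G\<^esub> y) \<and>
     continuous_map (gtop G) (gtop G) (\<lambda>x. inv\<^bsub>G\<^esub> x)"

record 'a top_semigroup = "'a partial_object" +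
  sgmult :: "'a \<Rightarrow> 'a \<Rightarrow> 'a"  (infixl \<open>\<cdot>\<index>\<close> 70)
  sgtop :: "'a topology"

definition is_semigroup :: "'a top_semigroup \<Rightarrow> bool" where
  "is_semigroup S \<longleftrightarrow>
     (\<forall>x \<in> carrier S. \<forall>y \<in> carrier S. x \<cdot>\<^bsub>S\<^esub> y \<in> carrier S) \<and>
     (\<forall>x \<in> carrier S. \<forall>y \<in> carrier S. \<forall>z \<in> carrier S.
        (x \<cdot>\<^bsub>S\<^esub> y) \<cdot>\<^bsub>S\<^esub> z = x \<cdot>\<^bsub>S\<^esub> (y \<cdot>\<^bsub>S\<^esub> z))"

definition inverse_of :: "'a top_semigroup \<Rightarrow> 'a \<Rightarrow> 'a \<Rightarrow> bool" where
  "inverse_of S x y \<longleftrightarrow>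
     y \<in> carrier S \<and> x \<cdot>\<^bsub>S\<^esub> y \<cdot>\<^bsub>S\<^esub> x = x \<and> y \<cdot>\<^bsub>S\<^esub> x \<cdot>\<^bsub>S\<^esub> y = y"

definition is_inverse_semigroup :: "'a top_semigroup \<Rightarrow> bool" where
  "is_inverse_semigroup S \<longleftrightarrow>
     is_semigroup S \<and> (\<forall>x \<in> carrier S. \<exists>!y. inverse_of S x y)"

definition sginv :: "'a top_semigroup \<Rightarrow> 'a \<Rightarrow> 'a" where
  "sginv S x = (THE y. inverse_of S x y)"

definition is_top_inverse_semigroup :: "'a top_semigroup \<Rightarrow> bool" where
  "is_top_inverse_semigroup S \<longleftrightarrow>
     is_inverse_semigroup S \<and> topspace (sgtop S) = carrier S \<and> Hausdorff_space (sgtop S) \<and>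
     continuous_map (prod_topology (sgtop S) (sgtop S)) (sgtop S) (\<lambda>(x, y). x \<cdot>\<^bsub>S\<^esub> y) \<and>
     continuous_map (sgtop S) (sgtop S) (sginv S)"

definition is_zero :: "'a top_semigroup \<Rightarrow> 'a \<Rightarrow> bool" where
  "is_zero S z \<longleftrightarrow>
     z \<in> carrier S \<and> (\<forall>x \<in> carrier S. z \<cdot>\<^bsub>S\<^esub> x = z \<and> x \<cdot>\<^bsub>S\<^esub> z = z)"

definition is_ideal :: "'a top_semigroup \<Rightarrow> 'a set \<Rightarrow> bool" where
  "is_ideal S J \<longleftrightarrow>
     J \<noteq> {} \<and> J \<subseteq> carrier S \<and>
     (\<forall>x \<in> carrier S. \<forall>j \<in> J. x \<cdot>\<^bsub>S\<^esub> j \<in> J \<and> j \<cdot>\<^bsub>S\<^esub> x \<in> J)"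

definition zero_simple :: "'a top_semigroup \<Rightarrow> bool" where
  "zero_simple S \<longleftrightarrow>
     (\<exists>z. is_zero S z \<and>
          {x \<cdot>\<^bsub>S\<^esub> y | x y. x \<in> carrier S \<and> y \<in> carrier S} \<noteq> {z} \<and>
          (\<forall>J. is_ideal S J \<longrightarrow> J = {z} \<or> J = carrier S))"

definition sg_hom :: "'a top_semigroup \<Rightarrow> 'b top_semigroup \<Rightarrow> ('a \<Rightarrow> 'b) set" where
  "sg_hom S T =
     {f. f \<in> carrier S \<rightarrow> carrier T \<and>
         (\<forall>x \<in> carrier S. \<forall>y \<in> carrier S. f (x \<cdot>\<^bsub>S\<^esub> y) = f x \<cdot>\<^bsub>T\<^esub> f y)}"

definition trivial_hom :: "'a top_semigroup \<Rightarrow> ('a \<Rightarrow> 'b) \<Rightarrow> bool" where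
  "trivial_hom S f \<longleftrightarrow> (\<exists>c. \<forall>x \<in> carrier S. f x = c)"

definition top_isomorphic :: "'a top_semigroup \<Rightarrow> 'b top_semigroup \<Rightarrow> bool" where
  "top_isomorphic S T \<longleftrightarrow> (\<exists>f \<in> sg_hom S T. homeomorphic_map (sgtop S) (sgtop T) f)"


section \<open>The two categories\<close>

text \<open>
  The parameter \<open>P\<close> is the compactness property (countable compactness or compactness).
  Maps are total functions in HOL; to make equality of morphisms mean equality
  as maps on the carriers, all components of morphisms are extensional on their domains.
  The objects are those whose carriers are subsets of the given type, which thus serves as a universe.
  Representativity of the Brandt functor needs this universe to be closed under
  \<open>I \<times> G \<times> I\<close> with a zero adjoined, up to equinumerosity; every infinite type is.
\<close>

type_synonym ('g, 'i) cobj = "'g top_group \<times> 'i set"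
type_synonym ('g, 'i) cmor = "('g \<Rightarrow> 'g) \<times> ('i \<Rightarrow> 'g) \<times> ('i \<Rightarrow> 'i)"

definition catC :: "('g topology \<Rightarrow> bool) \<Rightarrow> (('g, 'i) cobj, ('g, 'i) cmor) cat" where
  "catC P = \<lparr>
     Obj = {(G, I). is_top_group G \<and> P (gtop G) \<and> finite I \<and> I \<noteq> {}},
     Hom = (\<lambda>(G, I) (G', I').
       {(h, u, \<phi>). h \<in> hom G G' \<and> h \<in> extensional (carrier G) \<and>
                   continuous_map (gtop G) (gtop G') h \<and>
                   u \<in> I \<rightarrow>\<^sub>E carrier G' \<and>
                   \<phi> \<in> I \<rightarrow>\<^sub>E I' \<and> inj_on \<phi> I}),
     Idn = (\<lambda>(G, I). (\<lambda>g \<in> carrier G. g, \<lambda>\<alpha> \<in> I. \<one>\<^bsub>G\<^esub>, \<lambda>\<alpha> \<in> I. \<alpha>)),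
     Comp = (\<lambda>(G, I) (G', I') (G'', I'') (h', u', \<phi>') (h, u, \<phi>).
       (compose (carrier G) h' h,
        \<lambda>\<alpha> \<in> I. u' (\<phi> \<alpha>) \<otimes>\<^bsub>G''\<^esub> h' (u \<alpha>),
        compose I \<phi>' \<phi>)) \<rparr>"

definition catK :: "('s topology \<Rightarrow> bool) \<Rightarrow> ('s top_semigroup, 's \<Rightarrow> 's) cat" where
  "catK P = \<lparr>
     Obj = {S. is_top_inverse_semigroup S \<and> P (sgtop S) \<and> zero_simple S},
     Hom = (\<lambda>S T. {f. f \<in> sg_hom S T \<and> f \<in> extensional (carrier S) \<and>
                      continuous_map (sgtop S) (sgtop T) f \<and> \<not> trivial_hom S f}),
     Idn = (\<lambda>S. \<lambda>x \<in> carrier S. x),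
     Comp = (\<lambda>S T U g f. compose (carrier S) g f) \<rparr>"


section \<open>Brandt extensions\<close>

text \<open>\<open>None\<close> is the adjoined zero, \<open>Some (\<alpha>, g, \<beta>)\<close> is the triple.\<close>

definition brandt_carrier :: "'g top_group \<Rightarrow> 'i set \<Rightarrow> ('i \<times> 'g \<times> 'i) option set" where
  "brandt_carrier G I = insert None (Some ` (I \<times> carrier G \<times> I))"

definition brandt_mult ::
  "'g top_group \<Rightarrow> ('i \<times> 'g \<times> 'i) option \<Rightarrow> ('i \<times> 'g \<times> 'i) option \<Rightarrow> ('i \<times> 'g \<times> 'i) option" where
  "brandt_mult G x y =
     (case (x, y) of
        (Some (\<alpha>, a, \<beta>), Some (\<gamma>, b, \<delta>)) \<Rightarrow> if \<beta> = \<gamma> then Some (\<alpha>, a \<otimes>\<^bsub>G\<^esub> b, \<delta>) else None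
      | _ \<Rightarrow> None)"

definition brandt_topology ::
  "'g top_group \<Rightarrow> 'i set \<Rightarrow> ('i \<times> 'g \<times> 'i) option topology" where
  "brandt_topology G I =
     topology (\<lambda>U. U \<subseteq> brandt_carrier G I \<and>
       (\<forall>\<alpha> \<in> I. \<forall>\<beta> \<in> I. openin (gtop G) {g \<in> carrier G. Some (\<alpha>, g, \<beta>) \<in> U}))"

definition brandt_obj :: "('g, 'i) cobj \<Rightarrow> ('i \<times> 'g \<times> 'i) option top_semigroup" where
  "brandt_obj = (\<lambda>(G, I).
     \<lparr> carrier = brandt_carrier G I, sgmult = brandt_mult G, sgtop = brandt_topology G I \<rparr>)"

definition brandt_mor ::
  "('g, 'i) cobj \<Rightarrow> ('g, 'i) cobj \<Rightarrow> ('g, 'i) cmor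
     \<Rightarrow> ('i \<times> 'g \<times> 'i) option \<Rightarrow> ('i \<times> 'g \<times> 'i) option" where
  "brandt_mor = (\<lambda>(G, I) (G', I') (h, u, \<phi>).
     \<lambda>x \<in> brandt_carrier G I.
       (case x of
          None \<Rightarrow> None
        | Some (\<alpha>, g, \<beta>) \<Rightarrow> Some (\<phi> \<alpha>, u \<alpha> \<otimes>\<^bsub>G'\<^esub> h g \<otimes>\<^bsub>G'\<^esub> inv\<^bsub>G'\<^esub> (u \<beta>), \<phi> \<beta>)))"

text \<open>
  The following facts confirm that \<^const>\<open>brandt_topology\<close> is the topology in which the zero is
  isolated and every box is an open subspace homeomorphic to the group.
\<close>

lemma openin_brandt_topology:
  "openin (brandt_topology G I) U \<longleftrightarrow> U \<subseteq> brandt_carrier G I \<and>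
     (\<forall>\<alpha> \<in> I. \<forall>\<beta> \<in> I. openin (gtop G) {g \<in> carrier G. Some (\<alpha>, g, \<beta>) \<in> U})"
proof -
  let ?S = "\<lambda>\<alpha> \<beta> U. {g \<in> carrier G. Some (\<alpha>, g, \<beta>) \<in> U}"
  have int: "?S \<alpha> \<beta> (U \<inter> V) = ?S \<alpha> \<beta> U \<inter> ?S \<alpha> \<beta> V" for \<alpha> \<beta> U V by auto
  have un: "?S \<alpha> \<beta> (\<Union>\<K>) = (\<Union>U\<in>\<K>. ?S \<alpha> \<beta> U)" for \<alpha> \<beta> \<K> by auto
  have "istopology (\<lambda>U. U \<subseteq> brandt_carrier G I \<and> (\<forall>\<alpha> \<in> I. \<forall>\<beta> \<in> I. openin (gtop G) (?S \<alpha> \<beta> U)))"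
    unfolding istopology_def int un by (auto intro!: openin_Int openin_Union)
  then show ?thesis
    unfolding brandt_topology_def by (simp add: topology_inverse')
qed

lemma topspace_brandt_topology:
  assumes "topspace (gtop G) = carrier G"
  shows "topspace (brandt_topology G I) = brandt_carrier G I"
proof -
  have "{g \<in> carrier G. Some (\<alpha>, g, \<beta>) \<in> brandt_carrier G I} = topspace (gtop G)"
    if "\<alpha> \<in> I" "\<beta> \<in> I" for \<alpha> \<beta>
    using that assms by (auto simp: brandt_carrier_def)
  then have "openin (brandt_topology G I) (brandt_carrier G I)"
    by (simp add: openin_brandt_topology)
  then show ?thesis
    by (metis openin_brandt_topology openin_subset openin_topspace subset_antisym)
qed

lemma brandt_zero_isolated: "openin (brandt_topology G I) {None}"
  by (simp add: openin_brandt_topology brandt_carrier_def)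

lemma brandt_box:
  assumes "topspace (gtop G) = carrier G" "\<alpha> \<in> I" "\<beta> \<in> I"
  shows "openin (brandt_topology G I) ((\<lambda>g. Some (\<alpha>, g, \<beta>)) ` carrier G)"
    and "embedding_map (gtop G) (brandt_topology G I) (\<lambda>g. Some (\<alpha>, g, \<beta>))"
proof -
  let ?f = "\<lambda>g. Some (\<alpha>, g, \<beta>)"
  have op: "openin (brandt_topology G I) (?f ` V)" if V: "openin (gtop G) V" for V
  proof -
    have VG: "V \<subseteq> carrier G" using V assms(1) openin_subset by metis
    have "{g \<in> carrier G. Some (\<gamma>, g, \<delta>) \<in> ?f ` V} = (if \<gamma> = \<alpha> \<and> \<delta> = \<beta> then V else {})" for \<gamma> \<delta>
      using VG by auto
    then show ?thesis
      using V VG assms by (auto simp: openin_brandt_topology brandt_carrier_def)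
  qed
  show "openin (brandt_topology G I) (?f ` carrier G)"
    using op[of "carrier G"] assms(1) by (metis openin_topspace)
  have "continuous_map (gtop G) (brandt_topology G I) ?f"
    unfolding continuous_map_def topspace_brandt_topology[OF assms(1)]
    using assms by (auto simp: openin_brandt_topology brandt_carrier_def)
  moreover have "open_map (gtop G) (brandt_topology G I) ?f"
    using op by (simp add: open_map_def)
  moreover have "inj_on ?f (topspace (gtop G))"
    by (simp add: inj_on_def)
  ultimately show "embedding_map (gtop G) (brandt_topology G I) ?f"
    by (simp add: injective_open_imp_embedding_map)
qed


section \<open>Full representative functors into the category of inverse semigroups\<close>

definition full_representative_functor ::
  "('o, 'm) cat \<Rightarrow> ('s top_semigroup, 'n) cat
     \<Rightarrow> ('o \<Rightarrow> 's top_semigroup) \<Rightarrow> ('o \<Rightarrow> 'o \<Rightarrow> 'm \<Rightarrow> 'n) \<Rightarrow> bool" where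
  "full_representative_functor C D Fo Fm \<longleftrightarrow>
     is_functor C D Fo Fm \<and> is_full C D Fo Fm \<and> is_representative top_isomorphic C D Fo"

end

theory Submission
  imports Defs
begin

text \<open>
  Let \<open>S\<close> be a 0-simple countably compact topological inverse semigroup. Cluster points of powers show
  that \<open>S\<close> contains no bicyclic monoid, so every nonzero idempotent is primitive and any two of them
  are D-related. A second cluster point argument, applied to the elements that link infinitely many
  idempotents to a fixed one, shows that there are only finitely many idempotents. Hence \<open>s \<mapsto> ss\<^sup>-\<^sup>1\<close>
  and \<open>s \<mapsto> s\<^sup>-\<^sup>1s\<close> take values in a finite discrete set, the zero is isolated, the H-classes are
  clopen, and after choosing an element \<open>\<rho>\<^sub>i\<close> linking each idempotent to a base point \<open>e\<close>, the map
  \<open>(i, g, k) \<mapsto> \<rho>\<^sub>i g \<rho>\<^sub>k\<^sup>-\<^sup>1\<close> is a topological isomorphism from a Brandt semigroup over the group \<open>H\<^sub>e\<close>.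
  Primitivity also shows that a nontrivial homomorphism maps exactly the zero to zero; between
  Brandt semigroups it therefore acts coordinatewise, which gives fullness.
\<close>

section \<open>Inverse semigroups\<close>

text \<open>Countable compactness is not preserved by products and does not give convergent
  subsequences, so a joint cluster point of two sequences is not at hand. Every limit argument
  therefore uses one sequence in \<open>S\<close> and one cluster point \<open>x\<close>, and
  records which equations between continuous self-maps of \<open>S\<close> survive at
  \<open>x\<close>. Continuity of inversion makes this sufficient: both idempotents attached to an
  element are continuous functions of it, so one sequence controls both. A statement about two
  indices is treated by passing to the same cluster point twice, one index at a time.

  At the other end, types are the obstacle. The maximal subgroup and the idempotents found in
  \<open>S\<close> are elements of the type of \<open>S\<close>, while the objects of the source
  category live over \<open>'u\<close>. An injection into \<open>'u\<close> copies both, so the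
  structure theorem is stated for arbitrary copies.\<close>

locale inverse_semigroup =
  fixes S :: "'a top_semigroup" (structure)
  assumes inverse_semigroup: "is_inverse_semigroup S"
begin

abbreviation inver :: "'a \<Rightarrow> 'a" (\<open>_\<^sup>\<star>\<close> [1000] 1000) where "x\<^sup>\<star> \<equiv> sginv S x"

definition idem :: "'a \<Rightarrow> bool" where "idem e \<longleftrightarrow> e \<in> carrier S \<and> e \<cdot> e = e"

lemma mult_closed [simp]: "x \<in> carrier S \<Longrightarrow> y \<in> carrier S \<Longrightarrow> x \<cdot> y \<in> carrier S"
  using inverse_semigroup by (simp add: is_inverse_semigroup_def is_semigroup_def)

lemma assoc [simp]:
  "x \<in> carrier S \<Longrightarrow> y \<in> carrier S \<Longrightarrow> w \<in> carrier S \<Longrightarrow> (x \<cdot> y) \<cdot> w = x \<cdot> (y \<cdot> w)"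
  using inverse_semigroup by (simp add: is_inverse_semigroup_def is_semigroup_def)

text \<open>\<open>assoc\<close> is a simp rule that pushes brackets to the right, so a known
  product \<open>x \<cdot> y = a\<close> no longer matches at the front of a longer word. This form
  rewrites it there.\<close>

lemma mult_eq_assoc:
  "x \<cdot> y = a \<Longrightarrow> x \<in> carrier S \<Longrightarrow> y \<in> carrier S \<Longrightarrow> w \<in> carrier S \<Longrightarrow> x \<cdot> (y \<cdot> w) = a \<cdot> w"
  using assoc[of x y w] by simp

lemma inverse_of_sginv: "x \<in> carrier S \<Longrightarrow> inverse_of S x x\<^sup>\<star>"
  using inverse_semigroup unfolding is_inverse_semigroup_def sginv_def by (blast intro: theI')

lemma sginv_closed [simp]: "x \<in> carrier S \<Longrightarrow> x\<^sup>\<star> \<in> carrier S"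
  using inverse_of_sginv by (simp add: inverse_of_def)

lemma mult_sginv_mult [simp]: "x \<in> carrier S \<Longrightarrow> x \<cdot> (x\<^sup>\<star> \<cdot> x) = x"
  using inverse_of_sginv[of x] by (simp add: inverse_of_def)

lemma sginv_mult_sginv [simp]: "x \<in> carrier S \<Longrightarrow> x\<^sup>\<star> \<cdot> (x \<cdot> x\<^sup>\<star>) = x\<^sup>\<star>"
  using inverse_of_sginv[of x] by (simp add: inverse_of_def)

lemma mult_sginv_mult2 [simp]:
  "x \<in> carrier S \<Longrightarrow> y \<in> carrier S \<Longrightarrow> x \<cdot> (x\<^sup>\<star> \<cdot> (x \<cdot> y)) = x \<cdot> y"
  using mult_sginv_mult[of x] by (metis assoc mult_closed sginv_closed)

lemma sginv_mult_sginv2 [simp]: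
  "x \<in> carrier S \<Longrightarrow> y \<in> carrier S \<Longrightarrow> x\<^sup>\<star> \<cdot> (x \<cdot> (x\<^sup>\<star> \<cdot> y)) = x\<^sup>\<star> \<cdot> y"
  using sginv_mult_sginv[of x] by (metis assoc mult_closed sginv_closed)

lemma sginv_unique:
  assumes "x \<in> carrier S" "y \<in> carrier S" "x \<cdot> (y \<cdot> x) = x" "y \<cdot> (x \<cdot> y) = y"
  shows "x\<^sup>\<star> = y"
proof -
  have "inverse_of S x y" using assms by (simp add: inverse_of_def)
  then show ?thesis
    using inverse_semigroup inverse_of_sginv[of x] assms(1)
    unfolding is_inverse_semigroup_def by blast
qed

lemma sginv_sginv [simp]: "x \<in> carrier S \<Longrightarrow> x\<^sup>\<star>\<^sup>\<star> = x"
  by (rule sginv_unique) auto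

lemma idem_mult: "idem e \<Longrightarrow> e \<cdot> e = e"
  by (simp add: idem_def)

lemma idem_mult2: "idem e \<Longrightarrow> y \<in> carrier S \<Longrightarrow> e \<cdot> (e \<cdot> y) = e \<cdot> y"
  by (metis assoc idem_def)

lemma sginv_idem: "idem e \<Longrightarrow> e\<^sup>\<star> = e"
  by (rule sginv_unique) (auto simp: idem_def)

text \<open>With \<open>a\<close> the inverse of \<open>e \<cdot> f\<close>, the element
  \<open>f \<cdot> (a \<cdot> e)\<close> is an inverse too, hence equal to \<open>a\<close>. In that
  form \<open>a\<close> is seen to be idempotent, so it equals its own inverse, which is
  \<open>e \<cdot> f\<close>.\<close>

lemma idem_idem_mult:
  assumes "idem e" "idem f"
  shows "idem (e \<cdot> f)"
proof -
  have ef: "e \<in> carrier S" "f \<in> carrier S" using assms by (auto simp: idem_def)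
  note ids = idem_mult[OF assms(1)] idem_mult[OF assms(2)]
    idem_mult2[OF assms(1)] idem_mult2[OF assms(2)]
  define a where "a = (e \<cdot> f)\<^sup>\<star>"
  have a: "a \<in> carrier S" "e \<cdot> (f \<cdot> (a \<cdot> (e \<cdot> f))) = e \<cdot> f" "a \<cdot> (e \<cdot> (f \<cdot> a)) = a"
    using mult_sginv_mult[of "e \<cdot> f"] sginv_mult_sginv[of "e \<cdot> f"] ef
    by (auto simp: a_def simp del: mult_sginv_mult sginv_mult_sginv)
  have a3: "a \<cdot> (e \<cdot> (f \<cdot> (a \<cdot> y))) = a \<cdot> y" if "y \<in> carrier S" for y
    using a ef that by (metis assoc mult_closed)
  have "(e \<cdot> f)\<^sup>\<star> = f \<cdot> (a \<cdot> e)"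
    by (rule sginv_unique) (use ef a a3 in \<open>simp_all add: ids\<close>)
  then have fae: "f \<cdot> (a \<cdot> e) = a" by (simp add: a_def)
  have "(f \<cdot> (a \<cdot> e)) \<cdot> (f \<cdot> (a \<cdot> e)) = f \<cdot> (a \<cdot> e)"
    using ef a a3 by simp
  then have "idem a" unfolding fae using a by (simp add: idem_def)
  moreover have "a\<^sup>\<star> = e \<cdot> f" using ef by (simp add: a_def)
  ultimately show ?thesis using sginv_idem by metis
qed

text \<open>Both products are idempotent, which makes \<open>f \<cdot> e\<close> an inverse of
  \<open>e \<cdot> f\<close>; but an idempotent is its own inverse.\<close>

lemma idem_commute:
  assumes "idem e" "idem f"
  shows "e \<cdot> f = f \<cdot> e"
proof -
  have ef: "e \<in> carrier S" "f \<in> carrier S" using assms by (auto simp: idem_def)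
  note ids = idem_mult[OF assms(1)] idem_mult[OF assms(2)]
    idem_mult2[OF assms(1)] idem_mult2[OF assms(2)]
  have 1: "e \<cdot> (f \<cdot> (e \<cdot> f)) = e \<cdot> f"
    using idem_mult[OF idem_idem_mult[OF assms]] ef by simp
  have 2: "f \<cdot> (e \<cdot> (f \<cdot> e)) = f \<cdot> e"
    using idem_mult[OF idem_idem_mult[OF assms(2,1)]] ef by simp
  have "(e \<cdot> f)\<^sup>\<star> = f \<cdot> e"
    by (rule sginv_unique) (use ef 1 2 in \<open>simp_all add: ids\<close>)
  then show ?thesis using sginv_idem[OF idem_idem_mult[OF assms]] by simp
qed

lemma idem_mult_sginv: "x \<in> carrier S \<Longrightarrow> idem (x \<cdot> x\<^sup>\<star>)"
  by (simp add: idem_def)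

lemma idem_sginv_mult: "x \<in> carrier S \<Longrightarrow> idem (x\<^sup>\<star> \<cdot> x)"
  by (simp add: idem_def)

text \<open>Commuting the idempotents \<open>x\<^sup>\<star> \<cdot> x\<close> and
  \<open>y \<cdot> y\<^sup>\<star>\<close> brings each factor next to its own inverse.\<close>

lemma sginv_mult:
  assumes "x \<in> carrier S" "y \<in> carrier S"
  shows "(x \<cdot> y)\<^sup>\<star> = y\<^sup>\<star> \<cdot> x\<^sup>\<star>"
proof -
  have c: "x\<^sup>\<star> \<cdot> (x \<cdot> (y \<cdot> y\<^sup>\<star>)) = y \<cdot> (y\<^sup>\<star> \<cdot> (x\<^sup>\<star> \<cdot> x))"
    using idem_commute[of "x\<^sup>\<star> \<cdot> x" "y \<cdot> y\<^sup>\<star>"] assms by (simp add: idem_mult_sginv idem_sginv_mult)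
  have c2: "x\<^sup>\<star> \<cdot> (x \<cdot> (y \<cdot> (y\<^sup>\<star> \<cdot> w))) = y \<cdot> (y\<^sup>\<star> \<cdot> (x\<^sup>\<star> \<cdot> (x \<cdot> w)))" if "w \<in> carrier S" for w
    using arg_cong[OF c, of "\<lambda>t. t \<cdot> w"] that assms by simp
  show ?thesis
  proof (rule sginv_unique)
    show "x \<cdot> y \<cdot> (y\<^sup>\<star> \<cdot> x\<^sup>\<star> \<cdot> (x \<cdot> y)) = x \<cdot> y"
      using assms c2[of y] by (simp flip: c2)
    show "y\<^sup>\<star> \<cdot> x\<^sup>\<star> \<cdot> (x \<cdot> y \<cdot> (y\<^sup>\<star> \<cdot> x\<^sup>\<star>)) = y\<^sup>\<star> \<cdot> x\<^sup>\<star>"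
      using assms by (simp add: c2)
  qed (use assms in auto)
qed

text \<open>In the absence of an identity the zeroth power is
  \<open>p \<cdot> p\<^sup>\<star>\<close>, a left identity for \<open>p\<close>. Under the
  hypothesis of \<open>no_bicyclic\<close> it is two-sided, so the first power is then
  \<open>p\<close>.\<close>

primrec pow :: "'a \<Rightarrow> nat \<Rightarrow> 'a" where
  "pow p 0 = p \<cdot> p\<^sup>\<star>"
| "pow p (Suc n) = p \<cdot> pow p n"

lemma pow_closed [simp]: "p \<in> carrier S \<Longrightarrow> pow p n \<in> carrier S"
  by (induction n) auto

end

section \<open>Countably compact topological inverse semigroups\<close>

text \<open>The closures of the tails decrease. If their intersection were empty, their complements
  would be a countable cover, but finitely many of these miss every term of large index.\<close>

lemma countably_compact_cluster_point:
  assumes "countably_compact_space X" "\<And>n. s n \<in> topspace X"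
  obtains x where "x \<in> topspace X"
    "\<And>C. closedin X C \<Longrightarrow> \<forall>\<^sub>F n in sequentially. s n \<in> C \<Longrightarrow> x \<in> C"
proof -
  define K where "K n = X closure_of (s ` {n..})" for n :: nat
  have K: "closedin X (K n)" "s n \<in> K m" if "m \<le> n" for n m
    using that assms(2) closure_of_subset[of "s ` {m..}" X] by (auto simp: K_def)
  have "\<exists>x\<in>topspace X. \<forall>n. x \<in> K n"
  proof (rule ccontr)
    assume "\<not> ?thesis"
    then have cov: "topspace X \<subseteq> \<Union>(range (\<lambda>n. topspace X - K n))" by auto
    have "countable (range (\<lambda>n. topspace X - K n))"
         "\<forall>U\<in>range (\<lambda>n. topspace X - K n). openin X U"
      using K(1) by auto
    then obtain F where F: "finite F" "F \<subseteq> range (\<lambda>n. topspace X - K n)" "topspace X \<subseteq> \<Union>F"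
      using assms(1) cov unfolding countably_compact_space_def by meson
    then obtain N where N: "finite N" "F = (\<lambda>n. topspace X - K n) ` N"
      by (meson finite_subset_image subset_UNIV)
    \<comment> \<open>The inserted 0 keeps \<open>Max\<close> meaningful when the subcover is
      empty.\<close>
    have "s (Max (insert 0 N)) \<in> K n" if "n \<in> N" for n
      using that N by (intro K(2)) auto
    then show False using F(3) N assms(2)[of "Max (insert 0 N)"] by auto
  qed
  then obtain x where x: "x \<in> topspace X" "\<And>n. x \<in> K n" by blast
  show ?thesis
  proof
    show "x \<in> C" if C: "closedin X C" and ev: "\<forall>\<^sub>F n in sequentially. s n \<in> C" for C
    proof -
      obtain m where "\<And>n. n \<ge> m \<Longrightarrow> s n \<in> C" using ev by (auto simp: eventually_sequentially)
      then have "K m \<subseteq> C" unfolding K_def by (intro closure_of_minimal C) auto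
      then show ?thesis using x(2) by blast
    qed
  qed (rule x(1))
qed

locale top_inverse_semigroup =
  fixes S :: "'a top_semigroup" (structure)
  assumes top_inverse_semigroup: "is_top_inverse_semigroup S"

sublocale top_inverse_semigroup \<subseteq> inverse_semigroup
  using top_inverse_semigroup by unfold_locales (simp add: is_top_inverse_semigroup_def)

context top_inverse_semigroup
begin

lemma topspace_sgtop [simp]: "topspace (sgtop S) = carrier S"
  and Hausdorff_sgtop: "Hausdorff_space (sgtop S)"
  using top_inverse_semigroup by (auto simp: is_top_inverse_semigroup_def)

lemma continuous_sginv:
  assumes "continuous_map X (sgtop S) f"
  shows "continuous_map X (sgtop S) (\<lambda>x. (f x)\<^sup>\<star>)"
  using continuous_map_compose[OF assms, of "sgtop S" "sginv S"] top_inverse_semigroup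
  by (simp add: is_top_inverse_semigroup_def o_def)

lemma continuous_mult:
  assumes "continuous_map X (sgtop S) f" "continuous_map X (sgtop S) g"
  shows "continuous_map X (sgtop S) (\<lambda>x. f x \<cdot> g x)"
proof -
  have "continuous_map X (prod_topology (sgtop S) (sgtop S)) (\<lambda>x. (f x, g x))"
    using assms by (simp add: continuous_map_pairedI)
  from continuous_map_compose[OF this, of "sgtop S" "\<lambda>(x, y). x \<cdot> y"] show ?thesis
    using top_inverse_semigroup by (simp add: is_top_inverse_semigroup_def o_def)
qed

lemmas continuous_intro = continuous_mult continuous_sginv

lemma closedin_equaliser:
  assumes "continuous_map (sgtop S) (sgtop S) f" "continuous_map (sgtop S) (sgtop S) g"
  shows "closedin (sgtop S) {x \<in> carrier S. f x = g x}"
  using closedin_continuous_maps_eq[OF Hausdorff_sgtop assms] by simp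

end

locale countably_compact_inverse_semigroup = top_inverse_semigroup +
  assumes countably_compact: "countably_compact_space (sgtop S)"
begin

text \<open>Weaker than a topological cluster point: only equations between continuous self-maps
  that hold for almost all terms are inherited. Since \<open>S\<close> is Hausdorff, such equations
  define closed sets.\<close>

definition cluster_point :: "(nat \<Rightarrow> 'a) \<Rightarrow> 'a \<Rightarrow> bool" where
  "cluster_point s x \<longleftrightarrow> x \<in> carrier S \<and>
     (\<forall>f g. continuous_map (sgtop S) (sgtop S) f \<longrightarrow> continuous_map (sgtop S) (sgtop S) g \<longrightarrow>
        (\<forall>\<^sub>F n in sequentially. f (s n) = g (s n)) \<longrightarrow> f x = g x)"

lemma cluster_point_closed: "cluster_point s x \<Longrightarrow> x \<in> carrier S"
  by (simp add: cluster_point_def)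

lemma cluster_point_eq:
  assumes "cluster_point s x" "\<forall>\<^sub>F n in sequentially. f (s n) = g (s n)"
    "continuous_map (sgtop S) (sgtop S) f" "continuous_map (sgtop S) (sgtop S) g"
  shows "f x = g x"
  using assms by (simp add: cluster_point_def)

lemma cluster_point_exists:
  assumes "\<And>n. s n \<in> carrier S"
  obtains x where "cluster_point s x"
proof -
  obtain x where x: "x \<in> carrier S"
    "\<And>C. closedin (sgtop S) C \<Longrightarrow> \<forall>\<^sub>F n in sequentially. s n \<in> C \<Longrightarrow> x \<in> C"
    using countably_compact_cluster_point[OF countably_compact, of s] assms by auto
  have "f x = g x" if "continuous_map (sgtop S) (sgtop S) f" "continuous_map (sgtop S) (sgtop S) g"
      "\<forall>\<^sub>F n in sequentially. f (s n) = g (s n)" for f g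
    using x(2)[OF closedin_equaliser[OF that(1,2)]] that(3) assms by auto
  then have "cluster_point s x" using x(1) unfolding cluster_point_def by blast
  then show ?thesis by (rule that)
qed

text \<open>
  If \<open>p\<^sup>\<star>p\<close> lay strictly below \<open>pp\<^sup>\<star>\<close>, then \<open>p\<close> and \<open>p\<^sup>\<star>\<close> would generate a bicyclic monoid. A cluster
  point \<open>x\<close> of the powers of \<open>p\<close> satisfies \<open>xx\<^sup>\<star> = e\<close>, while \<open>g = x\<^sup>\<star>x\<close> lies below every \<open>p\<^sup>\<star>\<^sup>np\<^sup>n\<close>.
  As \<open>g\<close> commutes with \<open>p\<close>, it commutes with \<open>x\<close>, and this forces \<open>g = e\<close>.
\<close>

lemma no_bicyclic:
  assumes p: "p \<in> carrier S" and le: "(p \<cdot> p\<^sup>\<star>) \<cdot> (p\<^sup>\<star> \<cdot> p) = p\<^sup>\<star> \<cdot> p"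
  shows "p\<^sup>\<star> \<cdot> p = p \<cdot> p\<^sup>\<star>"
proof -
  define q e f where "q = p\<^sup>\<star>" and "e = p \<cdot> q" and "f = q \<cdot> p"
  define pw where "pw = pow p"
  \<comment> \<open>These idempotents descend from \<open>F 0 = e\<close> through
    \<open>F 1 = f\<close>; in a bicyclic monoid they would be strictly decreasing.\<close>
  define F where "F n = (pw n)\<^sup>\<star> \<cdot> pw n" for n
  have car [simp]: "p \<in> carrier S" "q \<in> carrier S" "e \<in> carrier S" "f \<in> carrier S" 
     "pw n \<in> carrier S" "F n \<in> carrier S" for n
    using p by (simp_all add: q_def e_def f_def pw_def F_def)
  have idem: "idem e" "idem f" "idem (F n)" for n
    using p by (simp_all add: e_def f_def q_def F_def idem_mult_sginv idem_sginv_mult)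
  have ef: "e \<cdot> f = f" using le by (simp add: e_def f_def q_def)
  then have fe: "f \<cdot> e = f" using idem_commute[OF idem(1,2)] by simp
  have ep: "e \<cdot> p = p" "p \<cdot> f = p" "f \<cdot> q = q" "q \<cdot> e = q"
    using p by (simp_all add: e_def f_def q_def)
  have pe: "p \<cdot> e = p" using mult_eq_assoc[OF ep(2), of e] fe ep(2) by simp
  have pw0: "pw 0 = e" by (simp add: pw_def e_def q_def)
  have pwS: "pw (Suc n) = p \<cdot> pw n" for n by (simp add: pw_def)
  \<comment> \<open>The recursion of \<open>pow\<close> multiplies on the left. Multiplying on the
    right instead exhibits \<open>F (Suc n)\<close> as the conjugate of \<open>F n\<close> by
    \<open>p\<close>.\<close>
  have pwS': "pw (Suc n) = pw n \<cdot> p" for n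
  proof (induction n)
    case (Suc n)
    show ?case by (subst pwS, subst Suc) (simp add: pwS)
  qed (simp add: pw0 pwS pe ep)
  have pwe: "pw n \<cdot> e = pw n" for n
    by (induction n) (auto simp: pw0 pwS idem_mult[OF idem(1)])
  have FS: "F (Suc n) = q \<cdot> (F n \<cdot> p)" for n
    by (simp add: F_def pwS' sginv_mult q_def)
  have F0: "F 0 = e" by (simp add: F_def pw0 sginv_idem idem idem_mult)
  have pwinv: "pw n \<cdot> (pw n)\<^sup>\<star> = e" for n
  proof (induction n)
    case (Suc n)
    have "pw (Suc n) \<cdot> (pw (Suc n))\<^sup>\<star> = pw n \<cdot> (p \<cdot> q) \<cdot> (pw n)\<^sup>\<star>"
      by (simp add: pwS' sginv_mult q_def)
    also have "\<dots> = e" using Suc pwe by (simp flip: e_def)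
    finally show ?case .
  qed (simp add: pw0 sginv_idem idem idem_mult)
  \<comment> \<open>Each \<open>F m\<close> fixes all later powers from the right, so in the limit
    it fixes \<open>x\<close>.\<close>
  have pwF: "pw n \<cdot> F m = pw n" if "m \<le> n" for m n
    using that
  proof (induction rule: dec_induct)
    case (step n)
    then show ?case by (simp add: pwS)
  qed (simp add: F_def)
  obtain x where cl: "cluster_point pw x"
    using cluster_point_exists[of pw] by auto
  have x [simp]: "x \<in> carrier S" by (rule cluster_point_closed[OF cl])
  have xx: "x \<cdot> x\<^sup>\<star> = e"
    using cluster_point_eq[OF cl, of "\<lambda>s. s \<cdot> s\<^sup>\<star>" "\<lambda>s. e"] by (simp add: pwinv continuous_intro)
  have xF: "x \<cdot> F m = x" for m
    using cluster_point_eq[OF cl, of "\<lambda>s. s \<cdot> F m" "\<lambda>s. s"] eventually_ge_at_top[of m] pwF[of m]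
    by (simp add: continuous_intro eventually_mono)
  \<comment> \<open>\<open>h\<close> is the conjugate of \<open>g\<close> by \<open>p\<close>, just
    as \<open>F (Suc n)\<close> is that of \<open>F n\<close>. The limit of this recursion suggests
    \<open>h = g\<close>; the two inequalities are proved separately.\<close>
  define g h where "g = x\<^sup>\<star> \<cdot> x" and "h = q \<cdot> (g \<cdot> p)"
  have gh [simp]: "g \<in> carrier S" "h \<in> carrier S" by (simp_all add: g_def h_def)
  have gF: "g \<cdot> F m = g" for m using xF by (simp add: g_def)
  have ge: "g \<cdot> e = g" using gF[of 0] F0 by simp
  have idg: "idem g" by (simp add: g_def idem_sginv_mult)
  have eg: "e \<cdot> g = g" using ge idem_commute[OF idg idem(1)] by simp
  have pq: "p \<cdot> (q \<cdot> w) = e \<cdot> w" if "w \<in> carrier S" for w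
    using that by (simp add: e_def)
  have geF: "g \<cdot> (e \<cdot> w) = g \<cdot> w" if "w \<in> carrier S" for w
    using that mult_eq_assoc[OF ge] by simp
  have gFw: "g \<cdot> (F m \<cdot> w) = g \<cdot> w" if "w \<in> carrier S" for w m
    using that mult_eq_assoc[OF gF] by simp
  have hF: "h \<cdot> F (Suc m) = h" for m
    by (simp add: h_def FS pq geF gFw)
  have "idem h"
    using idem_mult2[OF idg] by (simp add: idem_def h_def pq geF)
  \<comment> \<open>This is \<open>g \<cdot> F (Suc n) = g\<close> unfolded, so that at the cluster
    point the inner \<open>F n\<close> becomes \<open>g\<close> and the conjugate becomes
    \<open>h\<close>.\<close>
  have gqF: "g \<cdot> (q \<cdot> (((pw n)\<^sup>\<star> \<cdot> pw n) \<cdot> p)) = g" for n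
    using gF[of "Suc n"] FS[of n] by (simp add: F_def)
  have "\<forall>\<^sub>F n in sequentially. h \<cdot> F n = h"
    by (intro eventually_sequentiallyI[of 1]) (metis hF Suc_pred' less_eq_Suc_le One_nat_def)
  then have "h \<cdot> g = h"
    using cluster_point_eq[OF cl, of "\<lambda>s. h \<cdot> (s\<^sup>\<star> \<cdot> s)" "\<lambda>s. h"] by (simp add: continuous_intro g_def F_def)
  moreover have "g \<cdot> h = g"
    using cluster_point_eq[OF cl, of "\<lambda>s. g \<cdot> (q \<cdot> ((s\<^sup>\<star> \<cdot> s) \<cdot> p))" "\<lambda>s. g"] gqF
    unfolding h_def by (simp add: continuous_intro g_def)
  ultimately have hg: "h = g" using idem_commute[OF \<open>idem h\<close> idg] by simp
  \<comment> \<open>Multiplying \<open>q \<cdot> (g \<cdot> p) = g\<close> by \<open>p\<close> on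
    the left turns invariance under conjugation into commutation.\<close>
  have "p \<cdot> g = e \<cdot> (g \<cdot> p)" by (subst hg[symmetric]) (simp add: h_def pq)
  also have "\<dots> = g \<cdot> p" using mult_eq_assoc[OF eg, of p] by simp
  finally have pg: "p \<cdot> g = g \<cdot> p" .
  have pwg: "pw n \<cdot> g = g \<cdot> pw n" for n
  proof (induction n)
    case (Suc n)
    then have "pw (Suc n) \<cdot> g = (p \<cdot> g) \<cdot> pw n" by (simp add: pwS)
    then show ?case by (simp add: pg pwS)
  qed (simp add: pw0 eg ge)
  have "x \<cdot> g = g \<cdot> x"
    using cluster_point_eq[OF cl, of "\<lambda>s. s \<cdot> g" "\<lambda>s. g \<cdot> s"] by (simp add: pwg continuous_intro)
  \<comment> \<open>Here \<open>x \<cdot> g\<close> is \<open>x\<close> by definition of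
    \<open>g\<close>, so \<open>g\<close> becomes a left identity of \<open>x\<close> and hence of
    \<open>e = x \<cdot> x\<^sup>\<star>\<close>.\<close>
  then have "g \<cdot> x = x" by (simp add: g_def)
  then have "g \<cdot> e = e" using mult_eq_assoc[of g x x "x\<^sup>\<star>"] xx by simp
  then have "g = e" using ge by simp
  then have "e \<cdot> F 1 = e" using gF by metis
  then have "e \<cdot> f = e" using FS[of 0] F0 ep(1) by (simp add: f_def)
  then have "f = e" using ef by simp
  then show ?thesis by (simp add: e_def f_def q_def)
qed

end

section \<open>Zero-simple countably compact inverse semigroups\<close>

definition zero_of :: "'a top_semigroup \<Rightarrow> 'a" where
  "zero_of S = (THE z. is_zero S z)"

lemma is_zero_zero_of:
  assumes "is_zero S z"
  shows "zero_of S = z"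
  unfolding zero_of_def
proof (rule the_equality)
  fix y assume "is_zero S y"
  then show "y = z" using assms unfolding is_zero_def by metis
qed (rule assms)

locale zero_simple_inverse_semigroup = countably_compact_inverse_semigroup +
  assumes zero_simple: "zero_simple S"
begin

abbreviation zero :: 'a (\<open>\<zero>\<close>) where "\<zero> \<equiv> zero_of S"

lemma is_zero: "is_zero S \<zero>"
  and square_nonzero: "{x \<cdot> y | x y. x \<in> carrier S \<and> y \<in> carrier S} \<noteq> {\<zero>}"
  and ideal: "is_ideal S J \<Longrightarrow> J = {\<zero>} \<or> J = carrier S"
  using zero_simple is_zero_zero_of[of S] unfolding zero_simple_def by metis+

lemma zero_closed [simp]: "\<zero> \<in> carrier S"
  and zero_mult [simp]: "x \<in> carrier S \<Longrightarrow> \<zero> \<cdot> x = \<zero>"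
  and mult_zero [simp]: "x \<in> carrier S \<Longrightarrow> x \<cdot> \<zero> = \<zero>"
  using is_zero by (auto simp: is_zero_def)

lemma idem_zero: "idem \<zero>"
  by (simp add: idem_def)

lemma sginv_zero [simp]: "\<zero>\<^sup>\<star> = \<zero>"
  by (rule sginv_idem[OF idem_zero])

lemma mult_sginv_eq_zero [simp]: "x \<in> carrier S \<Longrightarrow> x \<cdot> x\<^sup>\<star> = \<zero> \<longleftrightarrow> x = \<zero>"
  by (metis assoc mult_sginv_mult sginv_closed zero_mult)

lemma sginv_mult_eq_zero [simp]: "x \<in> carrier S \<Longrightarrow> x\<^sup>\<star> \<cdot> x = \<zero> \<longleftrightarrow> x = \<zero>"
  by (metis mult_sginv_mult mult_zero sginv_zero)

text \<open>The set collects all nonzero idempotents; that they are minimal among nonzero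
  idempotents is the content of \<open>primitive\<close>.\<close>

definition primitives :: "'a set" where
  "primitives = {e. idem e \<and> e \<noteq> \<zero>}"

lemma primitives_nonempty: "primitives \<noteq> {}"
proof -
  have "\<exists>x \<in> carrier S. x \<noteq> \<zero>"
  proof (rule ccontr)
    assume "\<not> ?thesis"
    then have "x \<cdot> y = \<zero>" if "x \<in> carrier S" "y \<in> carrier S" for x y using that by auto
    then have "{x \<cdot> y | x y. x \<in> carrier S \<and> y \<in> carrier S} = {\<zero>}"
      by (auto intro!: exI[of _ "\<zero>"])
    then show False using square_nonzero by contradiction
  qed
  then obtain x where "x \<in> carrier S" "x \<noteq> \<zero>" by blast
  then have "x \<cdot> x\<^sup>\<star> \<in> primitives" by (simp add: primitives_def idem_mult_sginv)
  then show ?thesis by blast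
qed

text \<open>The products with middle factor \<open>f\<close> form an ideal. It contains
  \<open>f\<close>, with \<open>f \<cdot> f\<^sup>\<star>\<close> and
  \<open>f\<^sup>\<star> \<cdot> f\<close> standing in for an identity on either side, and so is all
  of \<open>S\<close>.\<close>

lemma factorisation:
  assumes f: "f \<in> carrier S" "f \<noteq> \<zero>" and x: "x \<in> carrier S"
  obtains a b where "a \<in> carrier S" "b \<in> carrier S" "x = a \<cdot> (f \<cdot> b)"
proof -
  define J where "J = {a \<cdot> (f \<cdot> b) | a b. a \<in> carrier S \<and> b \<in> carrier S}"
  have "f \<cdot> f\<^sup>\<star> \<cdot> (f \<cdot> (f\<^sup>\<star> \<cdot> f)) \<in> J"
    unfolding J_def
    by (intro CollectI exI[of _ "f \<cdot> f\<^sup>\<star>"] exI[of _ "f\<^sup>\<star> \<cdot> f"]) (use f in simp)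
  then have fJ: "f \<in> J" using f by simp
  have "is_ideal S J"
    unfolding is_ideal_def
  proof (intro conjI ballI)
    fix s j assume s: "s \<in> carrier S" and "j \<in> J"
    then obtain a b where ab: "a \<in> carrier S" "b \<in> carrier S" "j = a \<cdot> (f \<cdot> b)"
      unfolding J_def by blast
    have "s \<cdot> j = (s \<cdot> a) \<cdot> (f \<cdot> b)" "j \<cdot> s = a \<cdot> (f \<cdot> (b \<cdot> s))"
      using ab s f by simp_all
    then show "s \<cdot> j \<in> J" "j \<cdot> s \<in> J"
      using ab(1,2) s unfolding J_def by (metis (mono_tags, lifting) mem_Collect_eq mult_closed)+
  qed (use fJ f in \<open>auto simp: J_def\<close>)
  then have "J = carrier S" using ideal[of J] fJ f by auto
  then have "x \<in> J" using x by simp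
  then show ?thesis using that unfolding J_def by blast
qed

text \<open>If \<open>e = a \<cdot> (f \<cdot> b)\<close>, then
  \<open>e \<cdot> (a \<cdot> f)\<close> and \<open>f \<cdot> (b \<cdot> e)\<close> are mutually
  inverse with product \<open>e\<close>. So \<open>e\<close> is D-related to some idempotent below
  \<open>f\<close>; that it is \<open>f\<close> itself has to wait for primitivity.\<close>

lemma D_below:
  assumes e: "e \<in> primitives" and f: "f \<in> primitives"
  obtains x where "x \<in> carrier S" "x \<cdot> x\<^sup>\<star> = e" "f \<cdot> (x\<^sup>\<star> \<cdot> x) = x\<^sup>\<star> \<cdot> x"
proof -
  have ide: "idem e" and idf: "idem f" and c [simp]: "e \<in> carrier S" "f \<in> carrier S" "f \<noteq> \<zero>"
    using e f by (auto simp: primitives_def idem_def)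
  note ids = idem_mult[OF ide] idem_mult[OF idf] idem_mult2[OF ide] idem_mult2[OF idf]
  obtain a b where ab [simp]: "a \<in> carrier S" "b \<in> carrier S" and "e = a \<cdot> (f \<cdot> b)"
    using factorisation[of f e] by auto
  then have eab: "a \<cdot> (f \<cdot> b) = e" by simp
  have eabw: "a \<cdot> (f \<cdot> (b \<cdot> w)) = e \<cdot> w" if "w \<in> carrier S" for w
    using eab that by (metis ab assoc c(2) mult_closed)
  define x y where "x = e \<cdot> (a \<cdot> f)" and "y = f \<cdot> (b \<cdot> e)"
  have xy [simp]: "x \<in> carrier S" "y \<in> carrier S" by (simp_all add: x_def y_def)
  have xye: "x \<cdot> y = e" by (simp add: x_def y_def ids eabw)
  have "e \<cdot> x = x" "y \<cdot> e = y" "f \<cdot> y = y" by (simp_all add: x_def y_def ids)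
  then have inv: "x\<^sup>\<star> = y"
    using xye mult_eq_assoc[of x y e x] by (intro sginv_unique) auto
  show ?thesis
  proof
    show "f \<cdot> (x\<^sup>\<star> \<cdot> x) = x\<^sup>\<star> \<cdot> x"
      using mult_eq_assoc[OF \<open>f \<cdot> y = y\<close>, of x] by (simp add: inv)
  qed (simp_all add: inv xye)
qed

text \<open>\<open>D_below\<close> links \<open>e\<close> to an idempotent below \<open>f\<close>,
  hence below \<open>e\<close>. By \<open>no_bicyclic\<close> that idempotent is \<open>e\<close>,
  so \<open>e\<close> lies below \<open>f\<close> as well.\<close>

lemma primitive:
  assumes "idem e" "f \<in> primitives" "e \<cdot> f = f"
  shows "f = e"
proof -
  have idf: "idem f" and c [simp]: "e \<in> carrier S" "f \<in> carrier S" "f \<noteq> \<zero>"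
    using assms by (auto simp: primitives_def idem_def)
  then have "e \<noteq> \<zero>" using assms(3) by auto
  then obtain x where x [simp]: "x \<in> carrier S" and xx: "x \<cdot> x\<^sup>\<star> = e" "f \<cdot> (x\<^sup>\<star> \<cdot> x) = x\<^sup>\<star> \<cdot> x"
    using D_below[of e f] assms unfolding primitives_def by auto
  have "e \<cdot> (x\<^sup>\<star> \<cdot> x) = x\<^sup>\<star> \<cdot> x"
    using mult_eq_assoc[OF assms(3), of "x\<^sup>\<star> \<cdot> x"] xx(2) by simp
  then have "x\<^sup>\<star> \<cdot> x = e" using no_bicyclic[of x] xx(1) by simp
  then have "f \<cdot> e = e" using xx(2) by simp
  then show ?thesis using assms(3) idem_commute[OF assms(1) idf] by simp
qed

lemma D_related:
  assumes e: "e \<in> primitives" and f: "f \<in> primitives"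
  obtains x where "x \<in> carrier S" "x \<cdot> x\<^sup>\<star> = e" "x\<^sup>\<star> \<cdot> x = f"
proof -
  obtain x where x: "x \<in> carrier S" "x \<cdot> x\<^sup>\<star> = e" "f \<cdot> (x\<^sup>\<star> \<cdot> x) = x\<^sup>\<star> \<cdot> x"
    using D_below[OF e f] .
  have "x \<noteq> \<zero>" using e x by (auto simp: primitives_def)
  then have "x\<^sup>\<star> \<cdot> x \<in> primitives" using x(1) by (simp add: primitives_def idem_sginv_mult)
  then have "x\<^sup>\<star> \<cdot> x = f" using primitive[of f] f x(3) by (auto simp: primitives_def)
  then show ?thesis using that x by blast
qed

text \<open>A nonzero product would be a nonzero idempotent below both factors, hence equal to
  both.\<close>

lemma primitives_orthogonal:
  assumes e: "e \<in> primitives" and f: "f \<in> primitives" and "e \<noteq> f"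
  shows "e \<cdot> f = \<zero>"
proof (rule ccontr)
  assume nz: "e \<cdot> f \<noteq> \<zero>"
  have id: "idem e" "idem f" using e f by (auto simp: primitives_def)
  have c: "e \<in> carrier S" "f \<in> carrier S" using id by (auto simp: idem_def)
  have "e \<cdot> f \<in> primitives" using nz idem_idem_mult[OF id] by (simp add: primitives_def)
  then have "e \<cdot> f = e" "e \<cdot> f = f"
    using primitive[of e "e \<cdot> f"] primitive[of f "e \<cdot> f"] id c idem_mult2 idem_commute
    by (auto simp: idem_mult)
  then show False using assms by simp
qed

text \<open>
  Orthogonality makes any cluster point of distinct primitives \<open>\<epsilon>\<^sub>n = s\<^sub>ns\<^sub>n\<^sup>\<star>\<close> equal to zero, whereas
  \<open>s\<^sub>n\<^sup>\<star>s\<^sub>n\<close> can be kept equal to a fixed nonzero \<open>e\<close>; both are incompatible at a cluster point of the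
  \<open>s\<^sub>n\<close>.
\<close>

lemma finite_primitives: "finite primitives"
proof (rule ccontr)
  assume inf: "infinite primitives"
  then obtain \<epsilon> :: "nat \<Rightarrow> 'a" where inj: "inj \<epsilon>" and "range \<epsilon> \<subseteq> primitives"
    using infinite_countable_subset by blast
  then have \<epsilon>: "\<epsilon> n \<in> primitives" for n by auto
  then have c [simp]: "\<epsilon> n \<in> carrier S" for n by (simp add: primitives_def idem_def)
  obtain e where e: "e \<in> primitives" using primitives_nonempty by auto
  have "\<exists>x. x \<in> carrier S \<and> x \<cdot> x\<^sup>\<star> = \<epsilon> n \<and> x\<^sup>\<star> \<cdot> x = e" for n
    using D_related[OF \<epsilon>[of n] e] by metis
  then obtain s where s [simp]: "s n \<in> carrier S" and ss: "s n \<cdot> (s n)\<^sup>\<star> = \<epsilon> n" "(s n)\<^sup>\<star> \<cdot> s n = e" for n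
    by metis
  obtain x where cl: "cluster_point s x" using cluster_point_exists[of s] by auto
  have x [simp]: "x \<in> carrier S" by (rule cluster_point_closed[OF cl])
  \<comment> \<open>An iterated limit: the later index \<open>m\<close> runs while \<open>n\<close>
    is fixed, and only then does \<open>n\<close> run.\<close>
  have "\<epsilon> n \<cdot> (s m \<cdot> (s m)\<^sup>\<star>) = \<zero>" if "m > n" for m n
    using primitives_orthogonal[OF \<epsilon> \<epsilon>, of n m] injD[OF inj, of n m] that by (auto simp: ss)
  then have "\<epsilon> n \<cdot> (x \<cdot> x\<^sup>\<star>) = \<zero>" for n
    using cluster_point_eq[OF cl, of "\<lambda>s. \<epsilon> n \<cdot> (s \<cdot> s\<^sup>\<star>)" "\<lambda>s. \<zero>"] eventually_gt_at_top[of n]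
    by (simp add: continuous_intro eventually_mono)
  then have "x \<cdot> x\<^sup>\<star> \<cdot> (x \<cdot> x\<^sup>\<star>) = \<zero>"
    using cluster_point_eq[OF cl, of "\<lambda>s. s \<cdot> s\<^sup>\<star> \<cdot> (x \<cdot> x\<^sup>\<star>)" "\<lambda>s. \<zero>"]
    by (simp add: continuous_intro ss del: assoc)
  then have "x = \<zero>" by simp
  \<comment> \<open>The other idempotent of \<open>s n\<close> is constantly \<open>e\<close>, so it
    survives in the limit and contradicts \<open>x = \<zero>\<close>.\<close>
  moreover have "x\<^sup>\<star> \<cdot> x = e"
    using cluster_point_eq[OF cl, of "\<lambda>s. s\<^sup>\<star> \<cdot> s" "\<lambda>s. e"] e
    by (simp add: continuous_intro ss primitives_def idem_def)
  ultimately show False using e by (simp add: primitives_def)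
qed

end

text \<open>The image \<open>c\<close> of zero is a zero for the whole image of \<open>f\<close>.
  Were it nonzero in \<open>T\<close>, it would be an idempotent below the image of every idempotent
  of \<open>S\<close>, hence equal to it by primitivity in \<open>T\<close>, and \<open>f\<close>
  would be constant. So zero goes to zero, and the preimage of zero is a proper ideal.\<close>

lemma nontrivial_hom_eq_zero_iff:
  assumes S: "zero_simple_inverse_semigroup S" and T: "zero_simple_inverse_semigroup T"
    and f: "f \<in> sg_hom S T" "\<not> trivial_hom S f" and x: "x \<in> carrier S"
  shows "f x = zero_of T \<longleftrightarrow> x = zero_of S"
proof -
  interpret S: zero_simple_inverse_semigroup S by (rule S)
  interpret T: zero_simple_inverse_semigroup T by (rule T)
  have fc [simp]: "f y \<in> carrier T" if "y \<in> carrier S" for y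
    using f(1) that by (auto simp: sg_hom_def)
  have fm: "f (y \<cdot>\<^bsub>S\<^esub> w) = f y \<cdot>\<^bsub>T\<^esub> f w" if "y \<in> carrier S" "w \<in> carrier S" for y w
    using f(1) that by (auto simp: sg_hom_def)
  have fid: "T.idem (f e)" if "S.idem e" for e
    using that fm[of e e] by (simp add: S.idem_def T.idem_def)
  define c where "c = f (zero_of S)"
  have cl: "c \<cdot>\<^bsub>T\<^esub> f y = c" "f y \<cdot>\<^bsub>T\<^esub> c = c" if "y \<in> carrier S" for y
    using that fm[of "zero_of S" y] fm[of y "zero_of S"] by (simp_all add: c_def)
  have c0: "c = zero_of T"
  proof (rule ccontr)
    assume "c \<noteq> zero_of T"
    then have cp: "c \<in> T.primitives"
      using fid[OF S.idem_zero] by (simp add: T.primitives_def c_def)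
    have "f y = c" if y: "y \<in> carrier S" for y
    proof -
      have "c = f (y \<cdot>\<^bsub>S\<^esub> sginv S y)"
        by (rule T.primitive[OF fid[OF S.idem_mult_sginv[OF y]] cp]) (use y cl in simp)
      moreover have "f y = f (y \<cdot>\<^bsub>S\<^esub> sginv S y) \<cdot>\<^bsub>T\<^esub> f y"
        using y fm[of "y \<cdot>\<^bsub>S\<^esub> sginv S y" y] by simp
      ultimately show ?thesis using cl y by metis
    qed
    then show False using f(2) by (auto simp: trivial_hom_def)
  qed
  define J where "J = {y \<in> carrier S. f y = zero_of T}"
  have "is_ideal S J"
    using c0 by (auto simp: is_ideal_def J_def fm c_def intro!: exI[of _ "zero_of S"])
  moreover have "J \<noteq> carrier S"
    using f(2) by (auto simp: trivial_hom_def J_def)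
  ultimately have "J = {zero_of S}" using S.ideal by blast
  then show ?thesis using x by (auto simp: J_def)
qed

section \<open>Brandt semigroups over topological groups\<close>

text \<open>The flag restricts attention to countable covers, so that both halves of the theorem have one proof.\<close>

definition compact_wrt :: "bool \<Rightarrow> 'a topology \<Rightarrow> bool" where
  "compact_wrt c X \<longleftrightarrow>
     (\<forall>\<U>. (c \<longrightarrow> countable \<U>) \<and> (\<forall>U \<in> \<U>. openin X U) \<and> topspace X \<subseteq> \<Union>\<U> \<longrightarrow>
        (\<exists>\<F>. finite \<F> \<and> \<F> \<subseteq> \<U> \<and> topspace X \<subseteq> \<Union>\<F>))"

lemma compact_wrt_True: "compact_wrt True = countably_compact_space"
  by (simp add: fun_eq_iff compact_wrt_def countably_compact_space_def)

lemma compact_wrt_False: "compact_wrt False = compact_space"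
proof
  show "compact_wrt False X = compact_space X" for X :: "'a topology"
    unfolding compact_wrt_def compact_space_alt by auto
qed

lemma compact_wrt_imp_countably_compact: "compact_wrt c X \<Longrightarrow> countably_compact_space X"
  by (simp add: compact_wrt_def countably_compact_space_def)

text \<open>Preimages give a cover of \<open>X\<close>, countable if the given one is. The statement
  concerns the image rather than all of \<open>Y\<close> so that it applies to a single box of a
  Brandt semigroup.\<close>

lemma compact_wrt_subcover:
  assumes X: "compact_wrt c X" and f: "continuous_map X Y f"
    and \<U>: "c \<longrightarrow> countable \<U>" "\<And>U. U \<in> \<U> \<Longrightarrow> openin Y U" "f ` topspace X \<subseteq> \<Union>\<U>"
  shows "\<exists>\<F>. finite \<F> \<and> \<F> \<subseteq> \<U> \<and> f ` topspace X \<subseteq> \<Union>\<F>"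
proof -
  define p where "p U = {x \<in> topspace X. f x \<in> U}" for U
  have "(c \<longrightarrow> countable (p ` \<U>)) \<and> (\<forall>V \<in> p ` \<U>. openin X V) \<and> topspace X \<subseteq> \<Union>(p ` \<U>)"
    using \<U> openin_continuous_map_preimage[OF f] by (auto simp: p_def)
  then obtain \<G> where \<G>: "finite \<G>" "\<G> \<subseteq> p ` \<U>" "topspace X \<subseteq> \<Union>\<G>"
    using X unfolding compact_wrt_def by meson
  then obtain \<F> where "\<F> \<subseteq> \<U>" "finite \<F>" "\<G> = p ` \<F>"
    by (meson finite_subset_image)
  moreover from this have "f ` topspace X \<subseteq> \<Union>\<F>" using \<G>(3) by (auto simp: p_def)
  ultimately show ?thesis by blast
qed

lemma compact_wrt_image:
  assumes "compact_wrt c X" "continuous_map X Y f" "f ` topspace X = topspace Y"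
  shows "compact_wrt c Y"
  unfolding compact_wrt_def
proof (intro allI impI, elim conjE)
  fix \<U> assume "c \<longrightarrow> countable \<U>" "\<forall>U\<in>\<U>. openin Y U" "topspace Y \<subseteq> \<Union>\<U>"
  then show "\<exists>\<F>. finite \<F> \<and> \<F> \<subseteq> \<U> \<and> topspace Y \<subseteq> \<Union>\<F>"
    using compact_wrt_subcover[OF assms(1,2), of \<U>] assms(3) by simp
qed

text \<open>The open complement of \<open>C\<close> extends a cover of \<open>C\<close> to one of
  \<open>X\<close> without affecting countability, and is discarded from the subcover.\<close>

lemma compact_wrt_closedin:
  assumes X: "compact_wrt c X" and C: "closedin X C"
  shows "compact_wrt c (subtopology X C)"
  unfolding compact_wrt_def
proof (intro allI impI, elim conjE)
  have CX: "topspace (subtopology X C) = C" using C by (meson closedin_subset topspace_subtopology_subset)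
  fix \<U> assume \<U>: "c \<longrightarrow> countable \<U>" "\<forall>U\<in>\<U>. openin (subtopology X C) U"
    "topspace (subtopology X C) \<subseteq> \<Union>\<U>"
  then have "\<forall>U\<in>\<U>. \<exists>V. openin X V \<and> U = V \<inter> C" by (simp add: openin_subtopology)
  then obtain V where V: "\<And>U. U \<in> \<U> \<Longrightarrow> openin X (V U) \<and> U = V U \<inter> C" by metis
  define \<V> where "\<V> = insert (topspace X - C) (V ` \<U>)"
  have "C \<subseteq> \<Union>(V ` \<U>)" using \<U>(3) V unfolding CX by blast
  then have "(c \<longrightarrow> countable \<V>) \<and> (\<forall>W \<in> \<V>. openin X W) \<and> topspace X \<subseteq> \<Union>\<V>"
    using \<U>(1) V C by (auto simp: \<V>_def)
  then obtain \<G> where \<G>: "finite \<G>" "\<G> \<subseteq> \<V>" "topspace X \<subseteq> \<Union>\<G>"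
    using X unfolding compact_wrt_def by meson
  have "finite (\<G> - {topspace X - C})" "\<G> - {topspace X - C} \<subseteq> V ` \<U>"
    using \<G> by (auto simp: \<V>_def)
  then obtain \<F> where \<F>: "\<F> \<subseteq> \<U>" "finite \<F>" "\<G> - {topspace X - C} = V ` \<F>"
    by (meson finite_subset_image)
  have "C \<subseteq> \<Union>\<F>"
  proof
    fix x assume x: "x \<in> C"
    then obtain W where "W \<in> \<G>" "x \<in> W" using \<G>(3) C closedin_subset by blast
    then have "W \<in> V ` \<F>" using x \<F>(3) by blast
    then show "x \<in> \<Union>\<F>" using V \<F>(1) \<open>x \<in> W\<close> x by blast
  qed
  then show "\<exists>\<F>. finite \<F> \<and> \<F> \<subseteq> \<U> \<and> topspace (subtopology X C) \<subseteq> \<Union>\<F>"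
    using \<F> CX by auto
qed

section \<open>The Brandt space over a topological group: continuity and compactness\<close>

locale top_group =
  fixes G :: "'g top_group" (structure)
  assumes top_group: "is_top_group G"

sublocale top_group \<subseteq> group G
  using top_group by (simp add: is_top_group_def)

context top_group
begin

lemma topspace_gtop [simp]: "topspace (gtop G) = carrier G"
  and Hausdorff_gtop: "Hausdorff_space (gtop G)"
  and continuous_group_mult: "continuous_map (prod_topology (gtop G) (gtop G)) (gtop G) (\<lambda>(x, y). x \<otimes> y)"
  and continuous_group_inv: "continuous_map (gtop G) (gtop G) (\<lambda>x. inv x)"
  using top_group by (auto simp: is_top_group_def)

lemmas topspace_brandt [simp] = topspace_brandt_topology[OF topspace_gtop]

lemma openin_box_image:
  assumes "openin (gtop G) V" "\<alpha> \<in> I" "\<beta> \<in> I"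
  shows "openin (brandt_topology G I) ((\<lambda>g. Some (\<alpha>, g, \<beta>)) ` V)"
proof -
  have VG: "V \<subseteq> carrier G" using openin_subset[OF assms(1)] by simp
  have "{g \<in> carrier G. Some (\<gamma>, g, \<delta>) \<in> (\<lambda>g. Some (\<alpha>, g, \<beta>)) ` V} =
      (if \<gamma> = \<alpha> \<and> \<delta> = \<beta> then V else {})" for \<gamma> \<delta>
    using VG by auto
  then show ?thesis
    using VG assms by (auto simp: openin_brandt_topology brandt_carrier_def)
qed

lemma continuous_box:
  assumes "\<alpha> \<in> I" "\<beta> \<in> I"
  shows "continuous_map (gtop G) (brandt_topology G I) (\<lambda>g. Some (\<alpha>, g, \<beta>))"
  using assms by (auto simp: continuous_map_def openin_brandt_topology brandt_carrier_def)

text \<open>The Brandt space is the topological sum of its boxes and the isolated zero, so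
  continuity can be tested on each box separately.\<close>

lemma continuous_map_from_brandt:
  assumes "f None \<in> topspace Y"
    and "\<And>\<alpha> \<beta>. \<alpha> \<in> I \<Longrightarrow> \<beta> \<in> I \<Longrightarrow> continuous_map (gtop G) Y (\<lambda>g. f (Some (\<alpha>, g, \<beta>)))"
  shows "continuous_map (brandt_topology G I) Y f"
  unfolding continuous_map_def
proof (intro conjI allI impI)
  show "f \<in> topspace (brandt_topology G I) \<rightarrow> topspace Y"
    using assms by (auto simp: brandt_carrier_def continuous_map_def Pi_iff)
  fix U assume U: "openin Y U"
  have "{g \<in> carrier G. Some (\<alpha>, g, \<beta>) \<in> {x \<in> brandt_carrier G I. f x \<in> U}} =
      {g \<in> topspace (gtop G). f (Some (\<alpha>, g, \<beta>)) \<in> U}" if "\<alpha> \<in> I" "\<beta> \<in> I" for \<alpha> \<beta>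
    using that by (auto simp: brandt_carrier_def)
  then show "openin (brandt_topology G I) {x \<in> topspace (brandt_topology G I). f x \<in> U}"
    using openin_continuous_map_preimage[OF assms(2) U] by (auto simp: openin_brandt_topology)
qed

text \<open>The space consists of one point and finitely many continuous images of \<open>G\<close>.
  Finiteness of \<open>I\<close> keeps the union of the subcovers finite.\<close>

lemma compact_wrt_brandt:
  assumes G: "compact_wrt c (gtop G)" and I: "finite I"
  shows "compact_wrt c (brandt_topology G I)"
  unfolding compact_wrt_def
proof (intro allI impI, elim conjE)
  fix \<U> assume \<U>: "c \<longrightarrow> countable \<U>" "\<forall>U\<in>\<U>. openin (brandt_topology G I) U"
    "topspace (brandt_topology G I) \<subseteq> \<Union>\<U>"
  let ?b = "\<lambda>\<alpha> \<beta> g. Some (\<alpha>, g, \<beta>)"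
  define Q where "Q \<alpha> \<beta> \<F> \<longleftrightarrow> finite \<F> \<and> \<F> \<subseteq> \<U> \<and> ?b \<alpha> \<beta> ` carrier G \<subseteq> \<Union>\<F>" for \<alpha> \<beta> \<F>
  have Q: "\<exists>\<F>. Q \<alpha> \<beta> \<F>" if "\<alpha> \<in> I" "\<beta> \<in> I" for \<alpha> \<beta>
  proof -
    have "?b \<alpha> \<beta> ` carrier G \<subseteq> \<Union>\<U>" using \<U>(3) that by (auto simp: brandt_carrier_def)
    then show ?thesis
      using compact_wrt_subcover[OF G continuous_box[OF that], of \<U>] \<U> by (simp add: Q_def)
  qed
  define \<F> where "\<F> \<alpha> \<beta> = (SOME \<F>. Q \<alpha> \<beta> \<F>)" for \<alpha> \<beta>
  have \<F>: "finite (\<F> \<alpha> \<beta>)" "\<F> \<alpha> \<beta> \<subseteq> \<U>" "?b \<alpha> \<beta> ` carrier G \<subseteq> \<Union>(\<F> \<alpha> \<beta>)"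
    if "\<alpha> \<in> I" "\<beta> \<in> I" for \<alpha> \<beta>
    using someI_ex[OF Q[OF that]] by (auto simp: \<F>_def Q_def)
  obtain U where U: "U \<in> \<U>" "None \<in> U" using \<U>(3) by (auto simp: brandt_carrier_def)
  show "\<exists>\<F>. finite \<F> \<and> \<F> \<subseteq> \<U> \<and> topspace (brandt_topology G I) \<subseteq> \<Union>\<F>"
  proof (intro exI conjI)
    show "finite (insert U (\<Union>\<alpha>\<in>I. \<Union>\<beta>\<in>I. \<F> \<alpha> \<beta>))" using I \<F>(1) by simp
    show "insert U (\<Union>\<alpha>\<in>I. \<Union>\<beta>\<in>I. \<F> \<alpha> \<beta>) \<subseteq> \<U>"
      using \<F>(2) U(1) by (simp add: UN_subset_iff)
    have "?b \<alpha> \<beta> g \<in> (\<Union>\<alpha>\<in>I. \<Union>\<beta>\<in>I. \<Union>(\<F> \<alpha> \<beta>))" if "\<alpha> \<in> I" "\<beta> \<in> I" "g \<in> carrier G" for \<alpha> \<beta> g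
      by (rule UN_I[OF that(1)], rule UN_I[OF that(2)])
        (rule subsetD[OF \<F>(3)[OF that(1,2)] imageI[OF that(3)]])
    then have "Some ` (I \<times> carrier G \<times> I) \<subseteq> (\<Union>\<alpha>\<in>I. \<Union>\<beta>\<in>I. \<Union>(\<F> \<alpha> \<beta>))"
      by (simp add: image_subset_iff)
    then show "topspace (brandt_topology G I) \<subseteq> \<Union>(insert U (\<Union>\<alpha>\<in>I. \<Union>\<beta>\<in>I. \<F> \<alpha> \<beta>))"
      using U(2) by (auto simp: brandt_carrier_def)
  qed
qed

lemma brandt_obj_simps [simp]:
  "carrier (brandt_obj (G, I)) = brandt_carrier G I"
  "sgmult (brandt_obj (G, I)) = brandt_mult G"
  "sgtop (brandt_obj (G, I)) = brandt_topology G I"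
  by (simp_all add: brandt_obj_def)

lemma brandt_mult_simps [simp]:
  "brandt_mult G None y = None"
  "brandt_mult G x None = None"
  "brandt_mult G (Some (\<alpha>, a, \<beta>)) (Some (\<gamma>, b, \<delta>)) = (if \<beta> = \<gamma> then Some (\<alpha>, a \<otimes> b, \<delta>) else None)"
  by (auto simp: brandt_mult_def split: option.split)

lemma brandt_carrier_simps [simp]:
  "None \<in> brandt_carrier G I"
  "Some (\<alpha>, a, \<beta>) \<in> brandt_carrier G I \<longleftrightarrow> \<alpha> \<in> I \<and> a \<in> carrier G \<and> \<beta> \<in> I"
  by (auto simp: brandt_carrier_def)

lemma brandt_carrier_cases [consumes 1, case_names None Some]:
  assumes "x \<in> brandt_carrier G I"
  obtains "x = None" | \<alpha> a \<beta> where "x = Some (\<alpha>, a, \<beta>)" "\<alpha> \<in> I" "a \<in> carrier G" "\<beta> \<in> I"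
  using assms by (auto simp: brandt_carrier_def)

section \<open>The Brandt semigroup as a zero-simple topological inverse semigroup\<close>

definition brandt_inv :: "('i \<times> 'g \<times> 'i) option \<Rightarrow> ('i \<times> 'g \<times> 'i) option" where
  "brandt_inv x = (case x of None \<Rightarrow> None | Some (\<alpha>, a, \<beta>) \<Rightarrow> Some (\<beta>, inv a, \<alpha>))"

lemma brandt_semigroup: "is_semigroup (brandt_obj (G, I))"
  unfolding is_semigroup_def
proof (intro conjI ballI)
  fix x y assume "x \<in> carrier (brandt_obj (G, I))" "y \<in> carrier (brandt_obj (G, I))"
  then have xy: "x \<in> brandt_carrier G I" "y \<in> brandt_carrier G I" by simp_all
  then show "x \<cdot>\<^bsub>brandt_obj (G, I)\<^esub> y \<in> carrier (brandt_obj (G, I))"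
    by (cases rule: brandt_carrier_cases[case_product brandt_carrier_cases]) auto
  fix w assume "w \<in> carrier (brandt_obj (G, I))"
  then have "w \<in> brandt_carrier G I" by simp
  with xy show "x \<cdot>\<^bsub>brandt_obj (G, I)\<^esub> y \<cdot>\<^bsub>brandt_obj (G, I)\<^esub> w =
      x \<cdot>\<^bsub>brandt_obj (G, I)\<^esub> (y \<cdot>\<^bsub>brandt_obj (G, I)\<^esub> w)"
    by (elim brandt_carrier_cases) (auto simp: m_assoc)
qed

text \<open>For a nonzero \<open>x\<close>, the product of \<open>x\<close>, \<open>y\<close>,
  \<open>x\<close> is nonzero only if the indices of \<open>y\<close> are those of \<open>x\<close>
  reversed; then \<open>a \<otimes> b \<otimes> a = a\<close> determines \<open>b\<close> in the
  group. The equivalence yields existence, uniqueness and the formula for \<open>sginv\<close> at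
  once.\<close>

lemma brandt_inverse_of:
  assumes "x \<in> brandt_carrier G I"
  shows "inverse_of (brandt_obj (G, I)) x y \<longleftrightarrow> y = brandt_inv x"
proof
  assume y: "inverse_of (brandt_obj (G, I)) x y"
  then have "y \<in> brandt_carrier G I" by (simp add: inverse_of_def)
  with assms show "y = brandt_inv x"
  proof (elim brandt_carrier_cases, goal_cases)
    case (4 \<alpha> a \<beta> \<gamma> b \<delta>)
    then have eq: "\<gamma> = \<beta>" "\<delta> = \<alpha>" "a \<otimes> b \<otimes> a = a"
      using y by (auto simp: inverse_of_def split: if_splits)
    then have "a \<otimes> b = \<one>" using 4 right_cancel[of a "a \<otimes> b" \<one>] by simp
    then have "inv b = a" using 4 by (intro inv_equality) auto
    then have "b = inv a" using 4 inv_inv[of b] by simp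
    then show ?case using 4 eq by (simp add: brandt_inv_def)
  qed (use y in \<open>auto simp: inverse_of_def brandt_inv_def\<close>)
next
  assume "y = brandt_inv x"
  with assms show "inverse_of (brandt_obj (G, I)) x y"
    by (elim brandt_carrier_cases) (auto simp: inverse_of_def brandt_inv_def)
qed

lemma brandt_inverse_semigroup: "is_inverse_semigroup (brandt_obj (G, I))"
  using brandt_semigroup[of I] brandt_inverse_of[of _ I] by (simp add: is_inverse_semigroup_def)

lemma brandt_sginv: "x \<in> brandt_carrier G I \<Longrightarrow> sginv (brandt_obj (G, I)) x = brandt_inv x"
  by (simp add: sginv_def brandt_inverse_of)

lemma Hausdorff_brandt: "Hausdorff_space (brandt_topology G I)"
  unfolding Hausdorff_space_def
proof (intro allI impI, elim conjE)
  let ?B = "brandt_topology G I"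
  fix x y assume x: "x \<in> topspace ?B" and y: "y \<in> topspace ?B" and ne: "x \<noteq> y"
  have box: "openin ?B ((\<lambda>g. Some (\<alpha>, g, \<beta>)) ` carrier G)" if "\<alpha> \<in> I" "\<beta> \<in> I" for \<alpha> \<beta>
    using openin_box_image[of "carrier G"] openin_topspace[of "gtop G"] that by simp
  from x y have "x \<in> brandt_carrier G I" "y \<in> brandt_carrier G I" by simp_all
  then show "\<exists>U V. openin ?B U \<and> openin ?B V \<and> x \<in> U \<and> y \<in> V \<and> disjnt U V"
  proof (elim brandt_carrier_cases, goal_cases)
    case 1
    then show ?case using ne by simp
  next
    case (2 \<alpha> a \<beta>)
    then show ?case
      using box brandt_zero_isolated
      by (intro exI[of _ "{None}"] exI[of _ "(\<lambda>g. Some (\<alpha>, g, \<beta>)) ` carrier G"]) (auto simp: disjnt_def)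
  next
    case (3 \<alpha> a \<beta>)
    then show ?case
      using box brandt_zero_isolated
      by (intro exI[of _ "{None}"] exI[of _ "(\<lambda>g. Some (\<alpha>, g, \<beta>)) ` carrier G"]) (auto simp: disjnt_def)
  next
    case (4 \<alpha> a \<beta> \<gamma> b \<delta>)
    show ?case
    proof (cases "\<alpha> = \<gamma> \<and> \<beta> = \<delta>")
      case True
      then obtain U V where UV: "openin (gtop G) U" "openin (gtop G) V" "a \<in> U" "b \<in> V" "disjnt U V"
        using Hausdorff_gtop ne 4 unfolding Hausdorff_space_def by (metis topspace_gtop)
      show ?thesis
        using UV 4 True openin_box_image
        by (intro exI[of _ "(\<lambda>g. Some (\<alpha>, g, \<beta>)) ` U"] exI[of _ "(\<lambda>g. Some (\<alpha>, g, \<beta>)) ` V"])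
          (auto simp: disjnt_def)
    next
      case False
      then show ?thesis
        using 4 box
        by (intro exI[of _ "(\<lambda>g. Some (\<alpha>, g, \<beta>)) ` carrier G"]
            exI[of _ "(\<lambda>g. Some (\<gamma>, g, \<delta>)) ` carrier G"]) (auto simp: disjnt_def)
    qed
  qed
qed

lemma continuous_brandt_inv: "continuous_map (brandt_topology G I) (brandt_topology G I) brandt_inv"
proof (rule continuous_map_from_brandt)
  show "continuous_map (gtop G) (brandt_topology G I) (\<lambda>g. brandt_inv (Some (\<alpha>, g, \<beta>)))"
    if "\<alpha> \<in> I" "\<beta> \<in> I" for \<alpha> \<beta>
    using continuous_map_compose[OF continuous_group_inv continuous_box[OF that(2,1)]]
    by (simp add: brandt_inv_def o_def)
qed (simp add: brandt_inv_def)

text \<open>On a product of two boxes the multiplication is either constantly \<open>None\<close> or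
  the group multiplication into one box. Where a factor is zero, isolatedness of the zero gives an
  open rectangle on which the product is constant.\<close>

lemma continuous_brandt_mult:
  "continuous_map (prod_topology (brandt_topology G I) (brandt_topology G I)) (brandt_topology G I)
     (\<lambda>(x, y). brandt_mult G x y)"
  unfolding continuous_map_def
proof (intro conjI allI impI)
  let ?B = "brandt_topology G I"
  have closed: "brandt_mult G x y \<in> brandt_carrier G I"
    if "x \<in> brandt_carrier G I" "y \<in> brandt_carrier G I" for x y
    using that brandt_semigroup[of I] by (simp add: is_semigroup_def)
  then show "(\<lambda>(x, y). brandt_mult G x y) \<in> topspace (prod_topology ?B ?B) \<rightarrow> topspace ?B"
    by auto
  fix W assume W: "openin ?B W"
  have oB: "openin ?B (brandt_carrier G I)" using openin_topspace[of ?B] by simp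
  have box: "openin ?B ((\<lambda>g. Some (\<alpha>, g, \<beta>)) ` carrier G)" if "\<alpha> \<in> I" "\<beta> \<in> I" for \<alpha> \<beta>
    using openin_box_image[of "carrier G"] openin_topspace[of "gtop G"] that by simp
  show "openin (prod_topology ?B ?B) {p \<in> topspace (prod_topology ?B ?B). (case p of (x, y) \<Rightarrow> brandt_mult G x y) \<in> W}"
    (is "openin _ ?P")
    unfolding openin_prod_topology_alt
  proof (intro allI impI)
    fix x y assume xy: "(x, y) \<in> ?P"
    then have "x \<in> brandt_carrier G I" "y \<in> brandt_carrier G I" and m: "brandt_mult G x y \<in> W" by auto
    then show "\<exists>U V. openin ?B U \<and> openin ?B V \<and> x \<in> U \<and> y \<in> V \<and> U \<times> V \<subseteq> ?P"
    proof (elim brandt_carrier_cases, goal_cases)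
      case 1
      then show ?case using oB brandt_zero_isolated
        by (intro exI[of _ "{None}"] exI[of _ "brandt_carrier G I"]) auto
    next
      case (2 \<alpha> a \<beta>)
      then show ?case using oB brandt_zero_isolated
        by (intro exI[of _ "{None}"] exI[of _ "brandt_carrier G I"]) auto
    next
      case (3 \<alpha> a \<beta>)
      then show ?case using oB brandt_zero_isolated
        by (intro exI[of _ "{None}"] exI[of _ "brandt_carrier G I"]) auto
    next
      case (4 \<alpha> a \<beta> \<gamma> b \<delta>)
      show ?case
      proof (cases "\<beta> = \<gamma>")
        case False
        then show ?thesis
          using 4 box
          by (intro exI[of _ "(\<lambda>g. Some (\<alpha>, g, \<beta>)) ` carrier G"]
              exI[of _ "(\<lambda>g. Some (\<gamma>, g, \<delta>)) ` carrier G"]) auto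
      next
        case True
        define V where "V = {g \<in> carrier G. Some (\<alpha>, g, \<delta>) \<in> W}"
        have "openin (gtop G) V"
          using W 4 by (simp add: V_def openin_brandt_topology)
        then have "openin (prod_topology (gtop G) (gtop G))
            {p \<in> topspace (prod_topology (gtop G) (gtop G)). (case p of (x, y) \<Rightarrow> x \<otimes> y) \<in> V}"
          by (rule openin_continuous_map_preimage[OF continuous_group_mult])
        moreover have "(a, b) \<in> {p \<in> topspace (prod_topology (gtop G) (gtop G)). (case p of (x, y) \<Rightarrow> x \<otimes> y) \<in> V}"
          using 4 True by (simp add: V_def)
        ultimately obtain A B where AB: "openin (gtop G) A" "openin (gtop G) B" "a \<in> A" "b \<in> B"
          "A \<times> B \<subseteq> {p \<in> topspace (prod_topology (gtop G) (gtop G)). (case p of (x, y) \<Rightarrow> x \<otimes> y) \<in> V}"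
          unfolding openin_prod_topology_alt by meson
        show ?thesis
        proof (intro exI conjI)
          show "openin ?B ((\<lambda>g. Some (\<alpha>, g, \<beta>)) ` A)" "openin ?B ((\<lambda>g. Some (\<gamma>, g, \<delta>)) ` B)"
            using AB 4 openin_box_image by auto
          show "x \<in> (\<lambda>g. Some (\<alpha>, g, \<beta>)) ` A" "y \<in> (\<lambda>g. Some (\<gamma>, g, \<delta>)) ` B"
            using AB 4 by auto
          show "(\<lambda>g. Some (\<alpha>, g, \<beta>)) ` A \<times> (\<lambda>g. Some (\<gamma>, g, \<delta>)) ` B \<subseteq> ?P"
            using AB(5) 4 True by (auto simp: V_def dest!: subsetD)
        qed
      qed
    qed
  qed
qed

lemma brandt_top_inverse_semigroup: "is_top_inverse_semigroup (brandt_obj (G, I))"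
  using brandt_inverse_semigroup[of I] Hausdorff_brandt[of I] continuous_brandt_mult[of I]
    continuous_map_eq[OF continuous_brandt_inv[of I], of "sginv (brandt_obj (G, I))"]
  by (simp add: is_top_inverse_semigroup_def brandt_sginv)

lemma brandt_is_zero: "is_zero (brandt_obj (G, I)) None"
  by (simp add: is_zero_def)

lemma brandt_zero_simple:
  assumes "I \<noteq> {}"
  shows "zero_simple (brandt_obj (G, I))"
  unfolding zero_simple_def
proof (intro exI conjI allI impI)
  let ?B = "brandt_obj (G, I)"
  obtain \<alpha> where \<alpha>: "\<alpha> \<in> I" using assms by auto
  have "Some (\<alpha>, \<one>, \<alpha>) = Some (\<alpha>, \<one>, \<alpha>) \<cdot>\<^bsub>?B\<^esub> Some (\<alpha>, \<one>, \<alpha>)" by simp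
  moreover have "Some (\<alpha>, \<one>, \<alpha>) \<in> carrier ?B" using \<alpha> by simp
  ultimately have "Some (\<alpha>, \<one>, \<alpha>) \<in> {x \<cdot>\<^bsub>?B\<^esub> y | x y. x \<in> carrier ?B \<and> y \<in> carrier ?B}" by blast
  then show "{x \<cdot>\<^bsub>?B\<^esub> y | x y. x \<in> carrier ?B \<and> y \<in> carrier ?B} \<noteq> {None}" by auto
  fix J assume J: "is_ideal ?B J"
  then have sub: "J \<subseteq> brandt_carrier G I" and ne: "J \<noteq> {}"
    and id: "\<And>x j. x \<in> brandt_carrier G I \<Longrightarrow> j \<in> J \<Longrightarrow> brandt_mult G x j \<in> J \<and> brandt_mult G j x \<in> J"
    by (auto simp: is_ideal_def)
  have "None \<in> J" using ne id[of None] by auto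
  moreover have "x \<in> J" if j: "j \<in> J" "j \<noteq> None" and x: "x \<in> brandt_carrier G I" for j x
    using x
  proof (cases rule: brandt_carrier_cases)
    case None
    then show ?thesis using \<open>None \<in> J\<close> by simp
  next
    case (Some \<alpha> a \<beta>)
    obtain \<gamma> b \<delta> where jb: "j = Some (\<gamma>, b, \<delta>)" "\<gamma> \<in> I" "b \<in> carrier G" "\<delta> \<in> I"
      using j sub by (auto elim: brandt_carrier_cases)
    \<comment> \<open>The left factor cancels \<open>b\<close> and supplies \<open>a\<close>; the
      two factors together replace the outer indices of \<open>j\<close> by those of
      \<open>x\<close>.\<close>
    have "x = brandt_mult G (brandt_mult G (Some (\<alpha>, a \<otimes> inv b, \<gamma>)) j) (Some (\<delta>, \<one>, \<beta>))"
      using Some jb by (simp add: m_assoc)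
    also have "\<dots> \<in> J"
      using id j(1) jb(2-) Some(2-) by (intro id[THEN conjunct2] id[THEN conjunct1]) auto
    finally show ?thesis .
  qed
  ultimately have "brandt_carrier G I \<subseteq> J" if "J \<noteq> {None}" using that by blast
  then show "J = {None} \<or> J = carrier ?B" using sub by auto
qed (rule brandt_is_zero)

end

section \<open>Structure theorem\<close>

context inverse_semigroup
begin

text \<open>For idempotents \<open>e\<close> and \<open>f\<close> this is the R-class of
  \<open>e\<close> intersected with the L-class of \<open>f\<close>. With \<open>s\<close> seen as
  an arrow between \<open>e\<close> and \<open>f\<close>, these are the hom-sets of a groupoid whose
  inversion is \<open>sginv\<close>.\<close>

definition H_class :: "'a \<Rightarrow> 'a \<Rightarrow> 'a set" where
  "H_class e f = {s \<in> carrier S. s \<cdot> s\<^sup>\<star> = e \<and> s\<^sup>\<star> \<cdot> s = f}"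

lemma H_class_closed: "s \<in> H_class e f \<Longrightarrow> s \<in> carrier S"
  by (simp add: H_class_def)

lemma H_class_left: "s \<in> H_class e f \<Longrightarrow> s \<cdot> s\<^sup>\<star> = e"
  and H_class_right: "s \<in> H_class e f \<Longrightarrow> s\<^sup>\<star> \<cdot> s = f"
  by (simp_all add: H_class_def)

lemma H_class_left_unit: "s \<in> H_class e f \<Longrightarrow> e \<cdot> s = s"
  and H_class_right_unit: "s \<in> H_class e f \<Longrightarrow> s \<cdot> f = s"
  by (auto simp: H_class_def)

lemma H_class_sginv: "s \<in> H_class e f \<Longrightarrow> s\<^sup>\<star> \<in> H_class f e"
  by (simp add: H_class_def)

lemma H_class_mult:
  assumes s: "s \<in> H_class e f" and t: "t \<in> H_class f g"
  shows "s \<cdot> t \<in> H_class e g"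
proof -
  note [simp] = H_class_closed[OF s] H_class_closed[OF t]
  have "(s \<cdot> t) \<cdot> (s \<cdot> t)\<^sup>\<star> = s \<cdot> (t \<cdot> t\<^sup>\<star>) \<cdot> s\<^sup>\<star>" by (simp add: sginv_mult)
  also have "\<dots> = e" using H_class_left[OF t] H_class_right_unit[OF s] H_class_left[OF s] by metis
  finally have 1: "(s \<cdot> t) \<cdot> (s \<cdot> t)\<^sup>\<star> = e" .
  have "(s \<cdot> t)\<^sup>\<star> \<cdot> (s \<cdot> t) = t\<^sup>\<star> \<cdot> ((s\<^sup>\<star> \<cdot> s) \<cdot> t)" by (simp add: sginv_mult)
  also have "\<dots> = g" using H_class_right[OF s] H_class_left_unit[OF t] H_class_right[OF t] by metis
  finally show ?thesis using 1 unfolding H_class_def by simp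
qed

lemma H_class_idem: "idem e \<Longrightarrow> e \<in> H_class e e"
  by (simp add: H_class_def sginv_idem idem_def)

end

context zero_simple_inverse_semigroup
begin

lemma H_class_primitives:
  assumes "s \<in> carrier S" "s \<noteq> \<zero>"
  shows "s \<in> H_class (s \<cdot> s\<^sup>\<star>) (s\<^sup>\<star> \<cdot> s)" "s \<cdot> s\<^sup>\<star> \<in> primitives" "s\<^sup>\<star> \<cdot> s \<in> primitives"
  using assms by (auto simp: H_class_def primitives_def idem_mult_sginv idem_sginv_mult)

lemma zero_notin_H_class: "e \<in> primitives \<Longrightarrow> \<zero> \<notin> H_class e f"
  by (auto simp: H_class_def primitives_def)

lemma closedin_H_class:
  assumes "e \<in> primitives" "f \<in> primitives"
  shows "closedin (sgtop S) (H_class e f)"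
proof -
  have [simp]: "e \<in> carrier S" "f \<in> carrier S" using assms by (auto simp: primitives_def idem_def)
  have "H_class e f = {s \<in> carrier S. s \<cdot> s\<^sup>\<star> = e} \<inter> {s \<in> carrier S. s\<^sup>\<star> \<cdot> s = f}"
    by (auto simp: H_class_def)
  then show ?thesis
    by (simp add: closedin_Int closedin_equaliser continuous_intro)
qed

lemma closedin_zero: "closedin (sgtop S) {\<zero>}"
  using closedin_Hausdorff_singleton[OF Hausdorff_sgtop, of \<zero>] by simp

text \<open>The nonzero elements are the union of finitely many closed H-classes, one for each pair
  of nonzero idempotents.\<close>

lemma openin_zero: "openin (sgtop S) {\<zero>}"
proof -
  have "closedin (sgtop S) (\<Union>(e, f) \<in> primitives \<times> primitives. H_class e f)"
    using finite_primitives closedin_H_class by (intro closedin_Union) auto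
  moreover have "carrier S - (\<Union>(e, f) \<in> primitives \<times> primitives. H_class e f) = {\<zero>}"
  proof
    show "{\<zero>} \<subseteq> carrier S - (\<Union>(e, f) \<in> primitives \<times> primitives. H_class e f)"
      using zero_notin_H_class by auto
    show "carrier S - (\<Union>(e, f) \<in> primitives \<times> primitives. H_class e f) \<subseteq> {\<zero>}"
      using H_class_primitives by blast
  qed
  ultimately show ?thesis using openin_diff[OF openin_topspace] by fastforce
qed

text \<open>H-classes are pairwise disjoint, so the complement consists of zero and the finitely
  many other classes, all of them closed.\<close>

lemma openin_H_class:
  assumes "e \<in> primitives" "f \<in> primitives"
  shows "openin (sgtop S) (H_class e f)"
proof -
  define C where "C = {\<zero>} \<union> (\<Union>(a, b) \<in> primitives \<times> primitives - {(e, f)}. H_class a b)"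
  have "closedin (sgtop S) (\<Union>(a, b) \<in> primitives \<times> primitives - {(e, f)}. H_class a b)"
    using finite_primitives closedin_H_class by (intro closedin_Union) auto
  then have "closedin (sgtop S) C" unfolding C_def by (rule closedin_Un[OF closedin_zero])
  moreover have "carrier S - C = H_class e f"
  proof
    show "H_class e f \<subseteq> carrier S - C"
    proof
      fix s assume s: "s \<in> H_class e f"
      then have "s \<noteq> \<zero>" using zero_notin_H_class[OF assms(1)] by blast
      moreover have "(a, b) = (e, f)" if "s \<in> H_class a b" for a b
        using that s by (simp add: H_class_def)
      ultimately show "s \<in> carrier S - C" using s H_class_closed unfolding C_def by blast
    qed
    show "carrier S - C \<subseteq> H_class e f"
    proof
      fix s assume s: "s \<in> carrier S - C"
      then have "s \<noteq> \<zero>" by (auto simp: C_def)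
      then show "s \<in> H_class e f" using s H_class_primitives[of s] unfolding C_def by blast
    qed
  qed
  ultimately show ?thesis using openin_diff[OF openin_topspace, of "sgtop S" C] by simp
qed

definition maximal_group :: "'a \<Rightarrow> 'a top_group" where
  "maximal_group e = \<lparr>carrier = H_class e e, mult = (\<lambda>x y. x \<cdot> y), one = e,
     gtop = subtopology (sgtop S) (H_class e e)\<rparr>"

lemma maximal_group_simps [simp]:
  "carrier (maximal_group e) = H_class e e"
  "x \<otimes>\<^bsub>maximal_group e\<^esub> y = x \<cdot> y"
  "\<one>\<^bsub>maximal_group e\<^esub> = e"
  "gtop (maximal_group e) = subtopology (sgtop S) (H_class e e)"
  by (simp_all add: maximal_group_def)

lemma top_group_maximal_group:
  assumes "e \<in> primitives"
  shows "is_top_group (maximal_group e)"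
proof -
  have ide: "idem e" using assms by (simp add: primitives_def)
  have gr: "group (maximal_group e)"
  proof (rule groupI)
    show "\<one>\<^bsub>maximal_group e\<^esub> \<in> carrier (maximal_group e)" using H_class_idem[OF ide] by simp
    fix x assume "x \<in> carrier (maximal_group e)"
    then have x: "x \<in> H_class e e" by simp
    show "\<one>\<^bsub>maximal_group e\<^esub> \<otimes>\<^bsub>maximal_group e\<^esub> x = x" using H_class_left_unit[OF x] by simp
    show "\<exists>y\<in>carrier (maximal_group e). y \<otimes>\<^bsub>maximal_group e\<^esub> x = \<one>\<^bsub>maximal_group e\<^esub>"
      using H_class_sginv[OF x] H_class_right[OF x] by auto
  qed (auto simp: H_class_mult H_class_closed)
  have inv: "inv\<^bsub>maximal_group e\<^esub> x = x\<^sup>\<star>" if "x \<in> H_class e e" for x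
    using that H_class_sginv[OF that] H_class_right[OF that] by (intro group.inv_equality[OF gr]) auto
  have top: "topspace (subtopology (sgtop S) (H_class e e)) = H_class e e"
    by (auto simp: topspace_subtopology H_class_def)
  let ?T = "subtopology (sgtop S) (H_class e e)"
  have id: "continuous_map ?T (sgtop S) (\<lambda>x. x)" by (simp add: continuous_map_from_subtopology)
  have "continuous_map ?T ?T (\<lambda>x. x\<^sup>\<star>)"
    using continuous_sginv[OF id] H_class_sginv by (auto simp: continuous_map_in_subtopology top)
  then have "continuous_map ?T ?T (\<lambda>x. inv\<^bsub>maximal_group e\<^esub> x)"
    by (rule continuous_map_eq) (simp add: top inv)
  moreover have "continuous_map (prod_topology ?T ?T) ?T (\<lambda>p. fst p \<cdot> snd p)"
  proof -
    have "continuous_map (prod_topology ?T ?T) (sgtop S) (\<lambda>p. fst p \<cdot> snd p)"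
      using continuous_map_compose[OF continuous_map_fst id] continuous_map_compose[OF continuous_map_snd id]
      by (intro continuous_mult) (auto simp: o_def)
    then show ?thesis using H_class_mult by (auto simp: continuous_map_in_subtopology top)
  qed
  ultimately show ?thesis
    using gr top by (simp add: is_top_group_def Hausdorff_space_subtopology Hausdorff_sgtop case_prod_beta')
qed

text \<open>\<open>\<theta>\<close> and \<open>\<epsilon>\<close> allow the group and the index set
  to be copies living in another type. The isomorphism is built as \<open>\<Phi>\<close> from the
  Brandt semigroup to \<open>S\<close>, where continuity is tested on boxes, and is inverted at the
  end.\<close>

lemma top_isomorphic_brandt:
  assumes e: "e \<in> primitives" and G: "is_top_group G"
    and \<epsilon>: "bij_betw \<epsilon> I primitives"
    and \<theta>: "homeomorphic_map (gtop G) (subtopology (sgtop S) (H_class e e)) \<theta>"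
    and \<theta>_mult: "\<And>a b. a \<in> carrier G \<Longrightarrow> b \<in> carrier G \<Longrightarrow> \<theta> (a \<otimes>\<^bsub>G\<^esub> b) = \<theta> a \<cdot> \<theta> b"
  shows "top_isomorphic S (brandt_obj (G, I))"
proof -
  interpret G: top_group G by unfold_locales (rule G)
  have \<epsilon>p: "\<epsilon> i \<in> primitives" if "i \<in> I" for i using \<epsilon> that by (auto simp: bij_betw_def)
  have \<epsilon>_inj: "i = k" if "\<epsilon> i = \<epsilon> k" "i \<in> I" "k \<in> I" for i k
    using \<epsilon> that by (auto simp: bij_betw_def dest: inj_onD)
  have sub: "topspace (subtopology (sgtop S) (H_class e e)) = H_class e e"
    by (auto simp: topspace_subtopology H_class_def)
  have \<theta>_img: "\<theta> ` carrier G = H_class e e" and \<theta>_inj: "inj_on \<theta> (carrier G)"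
    using homeomorphic_imp_surjective_map[OF \<theta>] homeomorphic_imp_injective_map[OF \<theta>] sub by auto
  have \<theta>b: "\<theta> g \<in> H_class e e" if "g \<in> carrier G" for g using \<theta>_img that by blast
  have "\<exists>x. x \<in> H_class (\<epsilon> i) e" if "i \<in> I" for i
    using D_related[OF \<epsilon>p[OF that] e] unfolding H_class_def by blast
  then obtain \<rho> where \<rho>: "\<rho> i \<in> H_class (\<epsilon> i) e" if "i \<in> I" for i by metis
  have \<rho>c [simp]: "\<rho> i \<in> carrier S" if "i \<in> I" for i using H_class_closed[OF \<rho>[OF that]] .
  have \<theta>c [simp]: "\<theta> g \<in> carrier S" if "g \<in> carrier G" for g using H_class_closed[OF \<theta>b[OF that]] .
  \<comment> \<open>The units \<open>\<epsilon> i\<close> and \<open>\<epsilon> k\<close> can be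
    inserted between the two factors, and they are orthogonal.\<close>
  have orth: "(\<rho> i)\<^sup>\<star> \<cdot> \<rho> k = \<zero>" if "i \<in> I" "k \<in> I" "i \<noteq> k" for i k
  proof -
    have \<epsilon>\<epsilon>: "\<epsilon> i \<cdot> \<epsilon> k = \<zero>" using primitives_orthogonal \<epsilon>p \<epsilon>_inj that by blast
    have "(\<rho> i)\<^sup>\<star> \<cdot> \<rho> k = (\<rho> i)\<^sup>\<star> \<cdot> (\<rho> i \<cdot> (\<rho> i)\<^sup>\<star> \<cdot> (\<rho> k \<cdot> (\<rho> k)\<^sup>\<star>)) \<cdot> \<rho> k"
      using that by simp
    also have "\<dots> = \<zero>"
      using that by (simp add: H_class_left[OF \<rho>] \<epsilon>\<epsilon> del: assoc)
    finally show ?thesis .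
  qed
  define \<Phi> where "\<Phi> x = (case x of None \<Rightarrow> \<zero> | Some (i, g, k) \<Rightarrow> \<rho> i \<cdot> (\<theta> g \<cdot> (\<rho> k)\<^sup>\<star>))" for x
  have \<Phi>_None [simp]: "\<Phi> None = \<zero>" by (simp add: \<Phi>_def)
  have \<Phi>_Some: "\<Phi> (Some (i, g, k)) = \<rho> i \<cdot> (\<theta> g \<cdot> (\<rho> k)\<^sup>\<star>)" for i g k by (simp add: \<Phi>_def)
  have \<Phi>_H: "\<Phi> (Some (i, g, k)) \<in> H_class (\<epsilon> i) (\<epsilon> k)" if "i \<in> I" "g \<in> carrier G" "k \<in> I" for i g k
    unfolding \<Phi>_Some using that by (intro H_class_mult[OF \<rho>] H_class_mult[OF \<theta>b] H_class_sginv[OF \<rho>])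
  have \<Phi>_c [simp]: "\<Phi> x \<in> carrier S" if "x \<in> brandt_carrier G I" for x
    using that by (cases rule: G.brandt_carrier_cases) (auto intro: H_class_closed[OF \<Phi>_H])
  have \<Phi>_mult: "\<Phi> (brandt_mult G x y) = \<Phi> x \<cdot> \<Phi> y"
    if "x \<in> brandt_carrier G I" "y \<in> brandt_carrier G I" for x y
    using that
  proof (elim G.brandt_carrier_cases, goal_cases)
    case (4 i g k i' h l)
    show ?case
    proof (cases "k = i'")
      case True
      have "\<Phi> x \<cdot> \<Phi> y = \<rho> i \<cdot> (\<theta> g \<cdot> (((\<rho> k)\<^sup>\<star> \<cdot> \<rho> k) \<cdot> \<theta> h \<cdot> (\<rho> l)\<^sup>\<star>))"
        using 4 True by (simp add: \<Phi>_Some)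
      also have "((\<rho> k)\<^sup>\<star> \<cdot> \<rho> k) \<cdot> \<theta> h = \<theta> h"
        using 4 H_class_right[OF \<rho>] H_class_left_unit[OF \<theta>b] by simp
      finally show ?thesis using 4 True by (simp add: \<Phi>_Some \<theta>_mult)
    next
      case False
      have "\<Phi> x \<cdot> \<Phi> y = \<rho> i \<cdot> (\<theta> g \<cdot> (((\<rho> k)\<^sup>\<star> \<cdot> \<rho> i') \<cdot> (\<theta> h \<cdot> (\<rho> l)\<^sup>\<star>)))"
        using 4 by (simp add: \<Phi>_Some)
      also have "\<dots> = \<zero>" using 4 orth[of k i'] False by simp
      finally show ?thesis using 4 False by simp
    qed
  qed (use that in \<open>auto intro!: zero_mult[symmetric] mult_zero[symmetric]\<close>)
  \<comment> \<open>Up to \<open>\<theta>\<close>, \<open>\<pi> i k\<close> inverts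
    \<open>\<Phi>\<close> on the box of \<open>i\<close> and \<open>k\<close>; yet it is continuous
    on all of \<open>S\<close>.\<close>
  define \<pi> where "\<pi> i k s = (\<rho> i)\<^sup>\<star> \<cdot> (s \<cdot> \<rho> k)" for i k s
  have \<pi>_\<Phi>: "\<pi> i k (\<Phi> (Some (i, g, k))) = \<theta> g" if "i \<in> I" "g \<in> carrier G" "k \<in> I" for i g k
  proof -
    have "\<pi> i k (\<Phi> (Some (i, g, k))) = ((\<rho> i)\<^sup>\<star> \<cdot> \<rho> i) \<cdot> (\<theta> g \<cdot> ((\<rho> k)\<^sup>\<star> \<cdot> \<rho> k))"
      using that by (simp add: \<pi>_def \<Phi>_Some)
    then show ?thesis
      using that H_class_right[OF \<rho>] H_class_left_unit[OF \<theta>b] H_class_right_unit[OF \<theta>b] by simp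
  qed
  have \<pi>_H: "\<pi> i k s \<in> H_class e e" if "i \<in> I" "k \<in> I" "s \<in> H_class (\<epsilon> i) (\<epsilon> k)" for i k s
    unfolding \<pi>_def using that by (intro H_class_mult[OF H_class_sginv[OF \<rho>]] H_class_mult[OF _ \<rho>]) auto
  have \<Phi>_\<pi>: "\<rho> i \<cdot> (\<pi> i k s \<cdot> (\<rho> k)\<^sup>\<star>) = s" if "i \<in> I" "k \<in> I" "s \<in> H_class (\<epsilon> i) (\<epsilon> k)" for i k s
  proof -
    have "\<rho> i \<cdot> (\<pi> i k s \<cdot> (\<rho> k)\<^sup>\<star>) = (\<rho> i \<cdot> (\<rho> i)\<^sup>\<star>) \<cdot> (s \<cdot> (\<rho> k \<cdot> (\<rho> k)\<^sup>\<star>))"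
      using that H_class_closed[OF that(3)] by (simp add: \<pi>_def)
    then show ?thesis
      using that H_class_left[OF \<rho>] H_class_left_unit[OF that(3)] H_class_right_unit[OF that(3)] by simp
  qed
  \<comment> \<open>The image of a piece of a box becomes a preimage under \<open>\<pi> i k\<close>
    inside an open H-class, so that openness of \<open>\<Phi>\<close> follows from continuity of
    \<open>\<pi> i k\<close>.\<close>
  have \<Phi>_image: "\<Phi> ` ((\<lambda>g. Some (i, g, k)) ` V) = {s \<in> H_class (\<epsilon> i) (\<epsilon> k). \<pi> i k s \<in> \<theta> ` V}"
    if ik: "i \<in> I" "k \<in> I" and V: "V \<subseteq> carrier G" for i k V
  proof (intro equalityI subsetI)
    fix s assume "s \<in> \<Phi> ` ((\<lambda>g. Some (i, g, k)) ` V)"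
    then show "s \<in> {s \<in> H_class (\<epsilon> i) (\<epsilon> k). \<pi> i k s \<in> \<theta> ` V}"
      using ik V \<Phi>_H \<pi>_\<Phi> by auto
  next
    fix s assume "s \<in> {s \<in> H_class (\<epsilon> i) (\<epsilon> k). \<pi> i k s \<in> \<theta> ` V}"
    then obtain g where g: "g \<in> V" "\<pi> i k s = \<theta> g" "s \<in> H_class (\<epsilon> i) (\<epsilon> k)" by blast
    then have "s = \<Phi> (Some (i, g, k))" using \<Phi>_\<pi>[OF ik g(3)] by (simp add: \<Phi>_Some)
    then show "s \<in> \<Phi> ` ((\<lambda>g. Some (i, g, k)) ` V)" using g(1) by blast
  qed
  have "homeomorphic_map (brandt_topology G I) (sgtop S) \<Phi>"
  proof (rule bijective_open_imp_homeomorphic_map)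
    have \<theta>cont: "continuous_map (gtop G) (sgtop S) \<theta>"
      using homeomorphic_imp_continuous_map[OF \<theta>] by (simp add: continuous_map_in_subtopology)
    show "continuous_map (brandt_topology G I) (sgtop S) \<Phi>"
      by (rule G.continuous_map_from_brandt) (auto simp: \<Phi>_Some intro!: continuous_intro \<theta>cont)
    show "open_map (brandt_topology G I) (sgtop S) \<Phi>"
      unfolding open_map_def
    proof (intro allI impI)
      fix U assume U: "openin (brandt_topology G I) U"
      define V where "V i k = {g \<in> carrier G. Some (i, g, k) \<in> U}" for i k
      have UB: "U \<subseteq> brandt_carrier G I" using U by (simp add: openin_brandt_topology)
      have V: "openin (gtop G) (V i k)" if "i \<in> I" "k \<in> I" for i k
        using U that by (simp add: V_def openin_brandt_topology)
      have U_eq: "U = ({None} \<inter> U) \<union> (\<Union>i\<in>I. \<Union>k\<in>I. (\<lambda>g. Some (i, g, k)) ` V i k)"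
      proof (intro equalityI subsetI)
        fix x assume x: "x \<in> U"
        then have "x \<in> brandt_carrier G I" using UB by blast
        then show "x \<in> ({None} \<inter> U) \<union> (\<Union>i\<in>I. \<Union>k\<in>I. (\<lambda>g. Some (i, g, k)) ` V i k)"
          using x by (cases rule: G.brandt_carrier_cases) (auto simp: V_def)
      qed (auto simp: V_def)
      have eq: "\<Phi> ` U = \<Phi> ` ({None} \<inter> U) \<union> (\<Union>i\<in>I. \<Union>k\<in>I. \<Phi> ` ((\<lambda>g. Some (i, g, k)) ` V i k))"
        by (subst U_eq) (simp only: image_Un image_UN)
      have open_None: "openin (sgtop S) (\<Phi> ` ({None} \<inter> U))"
        using openin_zero by (cases "None \<in> U") auto
      have open_Some: "openin (sgtop S) (\<Phi> ` ((\<lambda>g. Some (i, g, k)) ` V i k))"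
        if ik: "i \<in> I" "k \<in> I" for i k
      proof -
        have "openin (subtopology (sgtop S) (H_class e e)) (\<theta> ` V i k)"
          using homeomorphic_imp_open_map[OF \<theta>] V[OF ik] by (simp add: open_map_def)
        then have "openin (sgtop S) (\<theta> ` V i k)"
          using openin_H_class[OF e e] by (simp add: openin_open_subtopology)
        moreover have "continuous_map (sgtop S) (sgtop S) (\<pi> i k)"
          using ik unfolding \<pi>_def by (simp add: continuous_intro)
        ultimately have "openin (sgtop S) {s \<in> topspace (sgtop S). \<pi> i k s \<in> \<theta> ` V i k}"
          by (rule openin_continuous_map_preimage[rotated])
        then have "openin (sgtop S) (H_class (\<epsilon> i) (\<epsilon> k) \<inter> {s \<in> topspace (sgtop S). \<pi> i k s \<in> \<theta> ` V i k})"
          using openin_H_class \<epsilon>p ik by (intro openin_Int) auto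
        moreover have "H_class (\<epsilon> i) (\<epsilon> k) \<inter> {s \<in> topspace (sgtop S). \<pi> i k s \<in> \<theta> ` V i k} =
            \<Phi> ` ((\<lambda>g. Some (i, g, k)) ` V i k)"
          using \<Phi>_image[OF ik, of "V i k"] H_class_closed by (auto simp: V_def)
        ultimately show ?thesis by simp
      qed
      show "openin (sgtop S) (\<Phi> ` U)"
        unfolding eq by (intro openin_Un open_None openin_Union) (auto intro!: openin_Union open_Some)
    qed
    have "s \<in> \<Phi> ` brandt_carrier G I" if s: "s \<in> carrier S" for s
    proof (cases "s = \<zero>")
      case True
      then show ?thesis by (intro image_eqI[of _ _ None]) auto
    next
      case False
      obtain i k where ik: "i \<in> I" "k \<in> I" "\<epsilon> i = s \<cdot> s\<^sup>\<star>" "\<epsilon> k = s\<^sup>\<star> \<cdot> s"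
        using H_class_primitives(2,3)[OF s False] \<epsilon> unfolding bij_betw_def by (metis imageE)
      have "s \<in> H_class (\<epsilon> i) (\<epsilon> k)" using H_class_primitives(1)[OF s False] ik by simp
      then have "s \<in> \<Phi> ` ((\<lambda>g. Some (i, g, k)) ` carrier G)"
        using \<Phi>_image[OF ik(1,2), of "carrier G"] \<pi>_H[OF ik(1,2)] \<theta>_img by simp
      then show ?thesis using ik by auto
    qed
    then show "\<Phi> ` topspace (brandt_topology G I) = topspace (sgtop S)" by auto
    have "x = y" if xy: "x \<in> brandt_carrier G I" "y \<in> brandt_carrier G I" "\<Phi> x = \<Phi> y" for x y
      using xy
    proof (elim G.brandt_carrier_cases, goal_cases)
      case (4 i g k i' h l)
      \<comment> \<open>The two idempotents of the image recover the indices, after which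
        \<open>\<pi>\<close> recovers the group coordinate.\<close>
      have "\<epsilon> i = \<epsilon> i'" "\<epsilon> k = \<epsilon> l"
        using \<Phi>_H[of i g k] \<Phi>_H[of i' h l] 4 by (auto simp: H_class_def)
      then have "i = i'" "k = l" using \<epsilon>_inj 4 by auto
      moreover from this have "\<theta> g = \<theta> h" using \<pi>_\<Phi>[of i g k] \<pi>_\<Phi>[of i' h l] 4 by simp
      ultimately show ?case using 4 \<theta>_inj by (auto dest: inj_onD)
    next
      case (2 i g k)
      then show ?case using \<Phi>_H[of i g k] zero_notin_H_class[OF \<epsilon>p, of i] by auto
    next
      case (3 i g k)
      then show ?case using \<Phi>_H[of i g k] zero_notin_H_class[OF \<epsilon>p, of i] by auto
    qed auto
    then show "inj_on \<Phi> (topspace (brandt_topology G I))" by (auto intro: inj_onI)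
  qed
  then obtain \<Psi> where \<Psi>: "homeomorphic_maps (brandt_topology G I) (sgtop S) \<Phi> \<Psi>"
    by (auto simp: homeomorphic_map_maps)
  then have \<Psi>h: "homeomorphic_map (sgtop S) (brandt_topology G I) \<Psi>"
    and \<Psi>\<Phi>: "\<And>x. x \<in> brandt_carrier G I \<Longrightarrow> \<Psi> (\<Phi> x) = x"
    and \<Phi>\<Psi>: "\<And>s. s \<in> carrier S \<Longrightarrow> \<Phi> (\<Psi> s) = s"
    by (auto simp: homeomorphic_maps_map)
  have \<Psi>c: "\<Psi> s \<in> brandt_carrier G I" if "s \<in> carrier S" for s
    using homeomorphic_imp_surjective_map[OF \<Psi>h] that by auto
  have "\<Psi> (s \<cdot> t) = brandt_mult G (\<Psi> s) (\<Psi> t)" if "s \<in> carrier S" "t \<in> carrier S" for s t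
  proof -
    have "\<Phi> (brandt_mult G (\<Psi> s) (\<Psi> t)) = s \<cdot> t"
      using that by (simp add: \<Phi>_mult \<Psi>c \<Phi>\<Psi>)
    moreover have "brandt_mult G (\<Psi> s) (\<Psi> t) \<in> brandt_carrier G I"
      using \<Psi>c that G.brandt_semigroup[of I] by (simp add: is_semigroup_def)
    ultimately show ?thesis using \<Psi>\<Phi> by metis
  qed
  then have "\<Psi> \<in> sg_hom S (brandt_obj (G, I))"
    using \<Psi>c by (auto simp: sg_hom_def)
  then show ?thesis using \<Psi>h by (auto simp: top_isomorphic_def)
qed

end

text \<open>A copy of \<open>G\<close> inside another type. For \<open>j\<close> injective on the
  carrier, pulling the topology back along the inverse makes \<open>j\<close> a homeomorphism onto
  the copy.\<close>

definition transport_group :: "('a \<Rightarrow> 'b) \<Rightarrow> 'a top_group \<Rightarrow> 'b top_group" where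
  "transport_group j G =
     \<lparr>carrier = j ` carrier G,
      mult = (\<lambda>x y. j (inv_into (carrier G) j x \<otimes>\<^bsub>G\<^esub> inv_into (carrier G) j y)),
      one = j \<one>\<^bsub>G\<^esub>,
      gtop = pullback_topology (j ` carrier G) (inv_into (carrier G) j) (gtop G)\<rparr>"

context top_group
begin

lemma homeomorphic_transport_group:
  assumes j: "inj_on j (carrier G)"
  shows "homeomorphic_maps (gtop G) (gtop (transport_group j G)) j (inv_into (carrier G) j)"
proof -
  let ?k = "inv_into (carrier G) j"
  have "continuous_map (gtop G) (gtop G) (?k \<circ> j)"
    by (rule continuous_map_eq[OF continuous_map_id]) (simp add: j)
  then have "continuous_map (gtop G) (gtop (transport_group j G)) j"
    by (simp add: transport_group_def) (rule continuous_map_pullback', auto)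
  moreover have "continuous_map (gtop (transport_group j G)) (gtop G) ?k"
    using continuous_map_pullback[OF continuous_map_id, of "j ` carrier G" ?k "gtop G"]
    by (simp add: transport_group_def)
  ultimately show ?thesis
    using j by (auto simp: homeomorphic_maps_def transport_group_def topspace_pullback_topology)
qed

lemma top_group_transport_group:
  assumes j: "inj_on j (carrier G)"
  shows "is_top_group (transport_group j G)"
proof -
  let ?H = "transport_group j G" and ?k = "inv_into (carrier G) j"
  have car: "carrier ?H = j ` carrier G"
    and mult: "\<And>x y. x \<otimes>\<^bsub>?H\<^esub> y = j (?k x \<otimes> ?k y)" and one: "\<one>\<^bsub>?H\<^esub> = j \<one>"
    by (simp_all add: transport_group_def)
  have kj [simp]: "?k (j x) = x" if "x \<in> carrier G" for x using j that by simp
  have gr: "group ?H"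
    by (rule groupI) (auto simp: car mult one m_assoc intro!: bexI[of _ "inv _"])
  have inv: "inv\<^bsub>?H\<^esub> y = j (inv (?k y))" if "y \<in> carrier ?H" for y
    using that by (intro group.inv_equality[OF gr]) (auto simp: car mult one)
  have hom: "homeomorphic_maps (gtop G) (gtop ?H) j ?k"
    by (rule homeomorphic_transport_group[OF j])
  have cj: "continuous_map (gtop G) (gtop ?H) j" and ck: "continuous_map (gtop ?H) (gtop G) ?k"
    using hom by (auto simp: homeomorphic_maps_def)
  have top: "topspace (gtop ?H) = carrier ?H"
    by (auto simp: transport_group_def topspace_pullback_topology)
  have "Hausdorff_space (gtop ?H)"
    using hom Hausdorff_gtop homeomorphic_Hausdorff_space homeomorphic_space_def by blast
  moreover have "continuous_map (gtop ?H) (gtop ?H) (\<lambda>y. inv\<^bsub>?H\<^esub> y)"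
    by (rule continuous_map_eq[OF continuous_map_compose[OF ck
          continuous_map_compose[OF continuous_group_inv cj]]]) (simp add: top inv)
  moreover have "continuous_map (prod_topology (gtop ?H) (gtop ?H)) (gtop ?H) (\<lambda>(x, y). x \<otimes>\<^bsub>?H\<^esub> y)"
  proof -
    have "continuous_map (prod_topology (gtop ?H) (gtop ?H)) (prod_topology (gtop G) (gtop G))
        (\<lambda>p. (?k (fst p), ?k (snd p)))"
      using continuous_map_compose[OF continuous_map_fst ck]
        continuous_map_compose[OF continuous_map_snd ck]
      by (intro continuous_map_pairedI) (auto simp: o_def)
    from continuous_map_compose[OF this continuous_map_compose[OF continuous_group_mult cj]]
    show ?thesis by (simp add: o_def mult case_prod_beta')
  qed
  ultimately show ?thesis using gr top by (simp add: is_top_group_def)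
qed

lemma brandt_zero_of: "zero_of (brandt_obj (G, I)) = None"
  by (rule is_zero_zero_of[OF brandt_is_zero])

lemma zero_simple_inverse_semigroup_brandt:
  assumes "compact_wrt c (gtop G)" "finite I" "I \<noteq> {}"
  shows "zero_simple_inverse_semigroup (brandt_obj (G, I))"
  using brandt_top_inverse_semigroup[of I] brandt_zero_simple[OF assms(3)]
    compact_wrt_imp_countably_compact[OF compact_wrt_brandt[OF assms(1,2)]]
  by unfold_locales simp_all

end

text \<open>Any nonzero idempotent serves as base point \<open>e\<close>. The group is the
  \<open>j\<close>-copy of its maximal subgroup, which is compact in the required sense as a closed
  subspace; the indices are the \<open>j\<close>-copies of the nonzero idempotents.\<close>

lemma (in zero_simple_inverse_semigroup) brandt_representation:
  fixes j :: "'a \<Rightarrow> 'u"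
  assumes c: "compact_wrt c (sgtop S)" and j: "inj j"
  shows "\<exists>(G :: 'u top_group) (I :: 'u set). is_top_group G \<and> compact_wrt c (gtop G) \<and>
    finite I \<and> I \<noteq> {} \<and> top_isomorphic S (brandt_obj (G, I))"
proof -
  obtain e where e: "e \<in> primitives" using primitives_nonempty by auto
  interpret H: top_group "maximal_group e"
    by unfold_locales (rule top_group_maximal_group[OF e])
  have inj: "inj_on j (H_class e e)" using j by (rule inj_on_subset) simp
  let ?G = "transport_group j (maximal_group e)" and ?k = "inv_into (H_class e e) j"
  have top: "is_top_group ?G" using H.top_group_transport_group inj by simp
  have hom: "homeomorphic_maps (subtopology (sgtop S) (H_class e e)) (gtop ?G) j ?k"
    using H.homeomorphic_transport_group[of j] inj by simp
  have mult: "?k (a \<otimes>\<^bsub>?G\<^esub> b) = ?k a \<cdot> ?k b" if "a \<in> carrier ?G" "b \<in> carrier ?G" for a b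
    using that inj by (auto simp: transport_group_def H_class_mult inv_into_f_f)
  have "compact_wrt c (gtop ?G)"
  proof (rule compact_wrt_image[OF compact_wrt_closedin[OF c closedin_H_class[OF e e]]])
    show "continuous_map (subtopology (sgtop S) (H_class e e)) (gtop ?G) j"
      using hom by (simp add: homeomorphic_maps_def)
    show "j ` topspace (subtopology (sgtop S) (H_class e e)) = topspace (gtop ?G)"
      using hom homeomorphic_imp_surjective_map homeomorphic_maps_map by blast
  qed
  moreover have "top_isomorphic S (brandt_obj (?G, j ` primitives))"
  proof (rule top_isomorphic_brandt[OF e top])
    show "bij_betw (inv_into primitives j) (j ` primitives) primitives"
      using j by (intro bij_betw_inv_into inj_on_imp_bij_betw) (rule inj_on_subset, auto)
    show "homeomorphic_map (gtop ?G) (subtopology (sgtop S) (H_class e e)) ?k"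
      using hom by (auto simp: homeomorphic_maps_map)
  qed (rule mult)
  ultimately show ?thesis
    using top finite_primitives primitives_nonempty by (intro exI conjI) auto
qed

lemma infinite_universe_embedding:
  assumes "infinite (UNIV :: 'u set)"
  obtains j :: "('u \<times> 'u \<times> 'u) option \<Rightarrow> 'u" where "inj j"
proof -
  obtain p :: "'u \<times> 'u \<Rightarrow> 'u" where "inj p"
    using ordIso_imp_ordLeq[OF card_of_Times_same_infinite[OF assms]]
    unfolding card_of_ordLeq[symmetric] by auto
  \<comment> \<open>\<open>h\<close> frees the point \<open>undefined\<close>, an arbitrary choice,
    to receive \<open>None\<close>; two uses of \<open>p\<close> encode a triple.\<close>
  obtain h :: "'u \<Rightarrow> 'u" where h: "bij_betw h UNIV (UNIV - {undefined})"
    using infinite_imp_bij_betw[OF assms] by blast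
  have h0: "h x \<noteq> undefined" for x using bij_betwE[OF h] by auto
  have hi: "h x = h y \<Longrightarrow> x = y" for x y using h by (auto simp: bij_betw_def inj_def)
  define j where "j x = (case x of None \<Rightarrow> undefined | Some (a, b, c) \<Rightarrow> h (p (a, p (b, c))))" for x
  have "inj j"
  proof (rule injI)
    fix x y assume "j x = j y"
    then show "x = y"
      using h0 h0[symmetric]
      by (auto simp: j_def split: option.splits dest!: hi injD[OF \<open>inj p\<close>])
  qed
  then show ?thesis by (rule that)
qed

section \<open>The Brandt functor\<close>

lemma catC_simps:
  "Obj (catC P) = {(G, I). is_top_group G \<and> P (gtop G) \<and> finite I \<and> I \<noteq> {}}"
  "Hom (catC P) (G, I) (G', I') =
     {(h, u, \<phi>). h \<in> hom G G' \<and> h \<in> extensional (carrier G) \<and> continuous_map (gtop G) (gtop G') h \<and>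
       u \<in> I \<rightarrow>\<^sub>E carrier G' \<and> \<phi> \<in> I \<rightarrow>\<^sub>E I' \<and> inj_on \<phi> I}"
  "Idn (catC P) (G, I) = (\<lambda>g \<in> carrier G. g, \<lambda>\<alpha> \<in> I. \<one>\<^bsub>G\<^esub>, \<lambda>\<alpha> \<in> I. \<alpha>)"
  "Comp (catC P) (G, I) (G', I') (G'', I'') (h', u', \<phi>') (h, u, \<phi>) =
     (compose (carrier G) h' h, \<lambda>\<alpha> \<in> I. u' (\<phi> \<alpha>) \<otimes>\<^bsub>G''\<^esub> h' (u \<alpha>), compose I \<phi>' \<phi>)"
  by (simp_all add: catC_def)

lemma catK_simps:
  "Obj (catK P) = {S. is_top_inverse_semigroup S \<and> P (sgtop S) \<and> zero_simple S}"
  "Hom (catK P) S T = {f. f \<in> sg_hom S T \<and> f \<in> extensional (carrier S) \<and>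
     continuous_map (sgtop S) (sgtop T) f \<and> \<not> trivial_hom S f}"
  "Idn (catK P) S = (\<lambda>x \<in> carrier S. x)"
  "Comp (catK P) S T U g f = compose (carrier S) g f"
  by (simp_all add: catK_def)

lemma catK_objD:
  "S \<in> Obj (catK (compact_wrt c)) \<Longrightarrow> zero_simple_inverse_semigroup S"
  unfolding catK_simps
  by unfold_locales (auto dest: compact_wrt_imp_countably_compact)

lemma (in zero_simple_inverse_semigroup) nonzero_exists: "\<exists>x \<in> carrier S. x \<noteq> \<zero>"
  using primitives_nonempty by (auto simp: primitives_def idem_def)

lemma (in zero_simple_inverse_semigroup) nontrivial_homI:
  assumes "\<And>x. x \<in> carrier S \<Longrightarrow> f x = w \<longleftrightarrow> x = \<zero>"
  shows "\<not> trivial_hom S f"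
  using assms nonzero_exists zero_closed unfolding trivial_hom_def by metis

text \<open>The axiom with content is closure under composition, since nontrivial maps may in
  general compose to a constant. Here both maps send only zero to zero, hence so does the
  composite.\<close>

lemma is_category_catK: "is_category (catK (compact_wrt c))"
  unfolding is_category_def
proof (intro conjI ballI)
  fix S :: "'a top_semigroup" assume "S \<in> Obj (catK (compact_wrt c))"
  then interpret S: zero_simple_inverse_semigroup S by (rule catK_objD)
  have "\<not> trivial_hom S (\<lambda>x \<in> carrier S. x)"
    by (rule S.nontrivial_homI[of _ "zero_of S"]) simp
  moreover have "continuous_map (sgtop S) (sgtop S) (\<lambda>x \<in> carrier S. x)"
    by (rule continuous_map_eq[OF continuous_map_id]) simp
  ultimately show "Idn (catK (compact_wrt c)) S \<in> Hom (catK (compact_wrt c)) S S"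
    by (auto simp: catK_simps sg_hom_def)
next
  fix S T U :: "'a top_semigroup" and f g
  assume S: "S \<in> Obj (catK (compact_wrt c))" and T: "T \<in> Obj (catK (compact_wrt c))"
    and U: "U \<in> Obj (catK (compact_wrt c))"
    and f: "f \<in> Hom (catK (compact_wrt c)) S T" and g: "g \<in> Hom (catK (compact_wrt c)) T U"
  interpret S: zero_simple_inverse_semigroup S by (rule catK_objD[OF S])
  interpret T: zero_simple_inverse_semigroup T by (rule catK_objD[OF T])
  have fc: "f x \<in> carrier T" if "x \<in> carrier S" for x
    using f that by (auto simp: catK_simps sg_hom_def)
  have "compose (carrier S) g f x = zero_of U \<longleftrightarrow> x = zero_of S" if "x \<in> carrier S" for x
    using nontrivial_hom_eq_zero_iff[OF catK_objD[OF S] catK_objD[OF T], of f x]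
      nontrivial_hom_eq_zero_iff[OF catK_objD[OF T] catK_objD[OF U], of g "f x"] f g fc that
    by (simp add: catK_simps compose_eq)
  then have "\<not> trivial_hom S (compose (carrier S) g f)" by (rule S.nontrivial_homI)
  moreover have "continuous_map (sgtop S) (sgtop U) (compose (carrier S) g f)"
    by (rule continuous_map_eq[OF continuous_map_compose[of _ "sgtop T" f _ g]])
      (use f g in \<open>auto simp: catK_simps compose_eq\<close>)
  ultimately show "Comp (catK (compact_wrt c)) S T U g f \<in> Hom (catK (compact_wrt c)) S U"
    using f g by (auto simp: catK_simps sg_hom_def compose_eq compose_extensional Pi_iff)
next
  fix S T :: "'a top_semigroup" and f
  assume "f \<in> Hom (catK (compact_wrt c)) S T"
  then show "Comp (catK (compact_wrt c)) S S T f (Idn (catK (compact_wrt c)) S) = f"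
    "Comp (catK (compact_wrt c)) S T T (Idn (catK (compact_wrt c)) T) f = f"
    by (auto simp: catK_simps sg_hom_def compose_def fun_eq_iff extensional_def)
next
  fix S T U W :: "'a top_semigroup" and f g h
  assume "f \<in> Hom (catK (compact_wrt c)) S T"
  then show "Comp (catK (compact_wrt c)) S T W (Comp (catK (compact_wrt c)) T U W h g) f =
      Comp (catK (compact_wrt c)) S U W h (Comp (catK (compact_wrt c)) S T U g f)"
    by (auto simp: catK_simps sg_hom_def compose_def fun_eq_iff)
qed

text \<open>The middle components compose as in a semidirect product: the unit law uses that
  \<open>h\<close> preserves \<open>\<one>\<close>, and associativity that the last group map is
  multiplicative.\<close>

lemma is_category_catC: "is_category (catC P)"
  unfolding is_category_def
proof (intro conjI ballI)
  fix a :: "('a, 'b) cobj" assume a: "a \<in> Obj (catC P)"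
  obtain G I where aGI: "a = (G, I)" by (cases a)
  interpret G: top_group G using a by unfold_locales (simp add: aGI catC_simps)
  have "continuous_map (gtop G) (gtop G) (\<lambda>x \<in> carrier G. x)"
    by (rule continuous_map_eq[OF continuous_map_id]) simp
  then show "Idn (catC P) a \<in> Hom (catC P) a a"
    by (auto simp: aGI catC_simps hom_def inj_on_def)
next
  fix a b d :: "('a, 'b) cobj" and f g
  assume a: "a \<in> Obj (catC P)" and b: "b \<in> Obj (catC P)" and d: "d \<in> Obj (catC P)"
    and f: "f \<in> Hom (catC P) a b" and g: "g \<in> Hom (catC P) b d"
  obtain G I G' I' G'' I'' where eq: "a = (G, I)" "b = (G', I')" "d = (G'', I'')"
    by (cases a, cases b, cases d)
  obtain h u \<phi> h' u' \<phi>' where fg: "f = (h, u, \<phi>)" "g = (h', u', \<phi>')" by (cases f, cases g)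
  interpret G: top_group G using a by unfold_locales (simp add: eq catC_simps)
  interpret G'': top_group G'' using d by unfold_locales (simp add: eq catC_simps)
  note F = f[unfolded eq fg catC_simps, simplified] and F' = g[unfolded eq fg catC_simps, simplified]
  have "compose (carrier G) h' h \<in> hom G G''"
    using F F' by (auto simp: hom_def compose_eq Pi_iff)
  moreover have "continuous_map (gtop G) (gtop G'') (compose (carrier G) h' h)"
    by (rule continuous_map_eq[OF continuous_map_compose[of _ "gtop G'" h _ h']])
      (use F F' in \<open>auto simp: compose_eq\<close>)
  moreover have "inj_on (compose I \<phi>' \<phi>) I"
    using F F' by (auto simp: inj_on_def compose_eq PiE_iff)
  moreover have "(\<lambda>\<alpha> \<in> I. u' (\<phi> \<alpha>) \<otimes>\<^bsub>G''\<^esub> h' (u \<alpha>)) \<in> I \<rightarrow>\<^sub>E carrier G''"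
    using F F' by (auto simp: PiE_iff hom_def Pi_iff)
  moreover have "compose I \<phi>' \<phi> \<in> I \<rightarrow>\<^sub>E I''"
    using F F' by (auto simp: PiE_iff compose_eq compose_extensional)
  ultimately show "Comp (catC P) a b d g f \<in> Hom (catC P) a d"
    by (simp add: eq fg catC_simps compose_extensional)
next
  fix a b :: "('a, 'b) cobj" and f
  assume a: "a \<in> Obj (catC P)" and b: "b \<in> Obj (catC P)" and f: "f \<in> Hom (catC P) a b"
  obtain G I G' I' where eq: "a = (G, I)" "b = (G', I')" by (cases a, cases b)
  obtain h u \<phi> where f': "f = (h, u, \<phi>)" by (cases f)
  interpret G: top_group G using a by unfold_locales (simp add: eq catC_simps)
  interpret G': top_group G' using b by unfold_locales (simp add: eq catC_simps)
  note F = f[unfolded eq f' catC_simps, simplified]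
  have h1: "h \<one>\<^bsub>G\<^esub> = \<one>\<^bsub>G'\<^esub>" using F hom_one G.group_axioms G'.group_axioms by blast
  have hc: "h x \<in> carrier G'" if "x \<in> carrier G" for x using F that by (auto simp: hom_def)
  show "Comp (catC P) a a b f (Idn (catC P) a) = f"
    using F h1 by (auto simp: eq f' catC_simps compose_def fun_eq_iff extensional_def PiE_iff)
  show "Comp (catC P) a b b (Idn (catC P) b) f = f"
    using F hc by (auto simp: eq f' catC_simps compose_def fun_eq_iff extensional_def PiE_iff)
next
  fix a b d e :: "('a, 'b) cobj" and f g k
  assume e: "e \<in> Obj (catC P)"
    and f: "f \<in> Hom (catC P) a b" and g: "g \<in> Hom (catC P) b d" and k: "k \<in> Hom (catC P) d e"
  obtain G I G' I' G'' I'' K J where eq: "a = (G, I)" "b = (G', I')" "d = (G'', I'')" "e = (K, J)"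
    by (cases a, cases b, cases d, cases e)
  obtain h u \<phi> h' u' \<phi>' h'' u'' \<phi>'' where
    fgk: "f = (h, u, \<phi>)" "g = (h', u', \<phi>')" "k = (h'', u'', \<phi>'')" by (cases f, cases g, cases k)
  interpret K: top_group K using e by unfold_locales (simp add: eq catC_simps)
  note F = f[unfolded eq fgk catC_simps, simplified] and F' = g[unfolded eq fgk catC_simps, simplified]
    and F'' = k[unfolded eq fgk catC_simps, simplified]
  have c: "h x \<in> carrier G'" if "x \<in> carrier G" for x using F that by (auto simp: hom_def)
  have c': "h' x \<in> carrier G''" if "x \<in> carrier G'" for x using F' that by (auto simp: hom_def)
  have c'': "h'' x \<in> carrier K" if "x \<in> carrier G''" for x using F'' that by (auto simp: hom_def)
  have m: "h'' (x \<otimes>\<^bsub>G''\<^esub> y) = h'' x \<otimes>\<^bsub>K\<^esub> h'' y" if "x \<in> carrier G''" "y \<in> carrier G''" for x y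
    using F'' that by (auto simp: hom_def)
  have u: "u i \<in> carrier G'" "\<phi> i \<in> I'" if "i \<in> I" for i using F that by auto
  have u': "u' i \<in> carrier G''" "\<phi>' i \<in> I''" if "i \<in> I'" for i using F' that by auto
  have u'': "u'' i \<in> carrier K" if "i \<in> I''" for i using F'' that by auto
  show "Comp (catC P) a b e (Comp (catC P) b d e k g) f = Comp (catC P) a d e k (Comp (catC P) a b d g f)"
    by (auto simp: eq fgk catC_simps compose_def fun_eq_iff c c' c'' m u u' u'' K.m_assoc)
qed

section \<open>The action of the Brandt construction on morphisms\<close>

locale catC_morphism =
  fixes c :: bool and G :: "'g top_group" and I :: "'i set" and G' :: "'g top_group" and I' :: "'i set"
    and h u \<phi>
  assumes dom: "(G, I) \<in> Obj (catC (compact_wrt c))"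
    and cod: "(G', I') \<in> Obj (catC (compact_wrt c))"
    and mor: "(h, u, \<phi>) \<in> Hom (catC (compact_wrt c)) (G, I) (G', I')"

sublocale catC_morphism \<subseteq> G: top_group G
  using dom by unfold_locales (simp add: catC_simps)

sublocale catC_morphism \<subseteq> G': top_group G'
  using cod by unfold_locales (simp add: catC_simps)

sublocale catC_morphism \<subseteq> group_hom G G' h
  using mor by unfold_locales (simp add: catC_simps)

context catC_morphism
begin

lemma u_closed [simp]: "i \<in> I \<Longrightarrow> u i \<in> carrier G'"
  and \<phi>_closed [simp]: "i \<in> I \<Longrightarrow> \<phi> i \<in> I'"
  and \<phi>_eq_iff [simp]: "i \<in> I \<Longrightarrow> k \<in> I \<Longrightarrow> \<phi> i = \<phi> k \<longleftrightarrow> i = k"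
  and h_continuous: "continuous_map (gtop G) (gtop G') h"
  and nonempty: "I \<noteq> {}"
  using mor dom by (auto simp: catC_simps dest: inj_onD)

lemma brandt_mor_None [simp]: "brandt_mor (G, I) (G', I') (h, u, \<phi>) None = None"
  by (simp add: brandt_mor_def)

lemma brandt_mor_Some [simp]:
  assumes "i \<in> I" "g \<in> carrier G" "k \<in> I"
  shows "brandt_mor (G, I) (G', I') (h, u, \<phi>) (Some (i, g, k)) =
    Some (\<phi> i, u i \<otimes>\<^bsub>G'\<^esub> h g \<otimes>\<^bsub>G'\<^esub> inv\<^bsub>G'\<^esub> (u k), \<phi> k)"
  using assms by (simp add: brandt_mor_def)

lemma translate_continuous:
  assumes "a \<in> carrier G'" "b \<in> carrier G'"
  shows "continuous_map (gtop G) (gtop G') (\<lambda>g. a \<otimes>\<^bsub>G'\<^esub> h g \<otimes>\<^bsub>G'\<^esub> b)"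
proof -
  have mult: "continuous_map (gtop G) (gtop G') (\<lambda>g. p g \<otimes>\<^bsub>G'\<^esub> q g)"
    if "continuous_map (gtop G) (gtop G') p" "continuous_map (gtop G) (gtop G') q" for p q
    using continuous_map_compose[OF continuous_map_pairedI[OF that] G'.continuous_group_mult]
    by (simp add: o_def)
  show ?thesis using assms by (intro mult h_continuous) auto
qed

text \<open>If the inner indices agree, the adjacent factors from \<open>u\<close> cancel; if they
  differ, injectivity of \<open>\<phi>\<close> keeps them different, so a zero product stays
  zero.\<close>

lemma brandt_mor_hom:
  "brandt_mor (G, I) (G', I') (h, u, \<phi>) \<in>
     Hom (catK (compact_wrt c)) (brandt_obj (G, I)) (brandt_obj (G', I'))"
proof -
  let ?f = "brandt_mor (G, I) (G', I') (h, u, \<phi>)"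
  have closed: "?f x \<in> brandt_carrier G' I'" if "x \<in> brandt_carrier G I" for x
    using that by (cases rule: G.brandt_carrier_cases) auto
  have cancel: "inv\<^bsub>G'\<^esub> a \<otimes>\<^bsub>G'\<^esub> (a \<otimes>\<^bsub>G'\<^esub> b) = b" if "a \<in> carrier G'" "b \<in> carrier G'" for a b
    using that by (metis G'.inv_closed G'.l_inv G'.l_one G'.m_assoc)
  have "?f (brandt_mult G x y) = brandt_mult G' (?f x) (?f y)"
    if "x \<in> brandt_carrier G I" "y \<in> brandt_carrier G I" for x y
    using that by (elim G.brandt_carrier_cases) (auto simp: G'.m_assoc cancel)
  moreover have "continuous_map (brandt_topology G I) (brandt_topology G' I') ?f"
  proof (rule G.continuous_map_from_brandt)
    fix i k assume ik: "i \<in> I" "k \<in> I"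
    have "continuous_map (gtop G) (brandt_topology G' I')
        ((\<lambda>g. Some (\<phi> i, g, \<phi> k)) \<circ> (\<lambda>g. u i \<otimes>\<^bsub>G'\<^esub> h g \<otimes>\<^bsub>G'\<^esub> inv\<^bsub>G'\<^esub> (u k)))"
      using ik by (intro continuous_map_compose[OF translate_continuous G'.continuous_box]) auto
    then show "continuous_map (gtop G) (brandt_topology G' I') (\<lambda>g. ?f (Some (i, g, k)))"
      by (rule continuous_map_eq) (use ik in simp)
  qed simp
  moreover have "\<not> trivial_hom (brandt_obj (G, I)) ?f"
  proof -
    obtain i where i: "i \<in> I" using nonempty by auto
    have "?f None \<noteq> ?f (Some (i, \<one>\<^bsub>G\<^esub>, i))" using i by simp
    moreover have "Some (i, \<one>\<^bsub>G\<^esub>, i) \<in> brandt_carrier G I" using i by simp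
    ultimately show ?thesis unfolding trivial_hom_def by (metis G.brandt_carrier_simps(1) G.brandt_obj_simps(1))
  qed
  moreover have "?f \<in> extensional (brandt_carrier G I)" by (simp add: brandt_mor_def)
  ultimately show ?thesis using closed by (auto simp: catK_simps sg_hom_def)
qed

end

text \<open>Applying \<open>h'\<close> to the middle coordinate produced by \<open>f\<close> and
  framing it with values of \<open>u'\<close> groups the outer factors into
  \<open>u' (\<phi> \<alpha>) \<otimes> h' (u \<alpha>)\<close> and the inverse of such a product.
  This is where the composition law of the source comes from.\<close>

lemma is_functor_brandt:
  "is_functor (catC (compact_wrt c)) (catK (compact_wrt c)) brandt_obj brandt_mor"
  unfolding is_functor_def
proof (intro conjI ballI is_category_catC is_category_catK)
  fix a :: "('a, 'b) cobj" assume a: "a \<in> Obj (catC (compact_wrt c))"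
  obtain G I where aGI: "a = (G, I)" by (cases a)
  interpret G: top_group G using a by unfold_locales (simp add: aGI catC_simps)
  show "brandt_obj a \<in> Obj (catK (compact_wrt c))"
    using a G.brandt_top_inverse_semigroup[of I] G.brandt_zero_simple[of I] G.compact_wrt_brandt[of c I]
    by (simp add: aGI catC_simps catK_simps)
  show "brandt_mor a a (Idn (catC (compact_wrt c)) a) = Idn (catK (compact_wrt c)) (brandt_obj a)"
  proof
    fix x
    show "brandt_mor a a (Idn (catC (compact_wrt c)) a) x = Idn (catK (compact_wrt c)) (brandt_obj a) x"
    proof (cases "x \<in> brandt_carrier G I")
      case True
      then show ?thesis
        by (cases rule: G.brandt_carrier_cases) (auto simp: aGI catC_simps catK_simps brandt_mor_def)
    qed (simp add: aGI catC_simps catK_simps brandt_mor_def)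
  qed
next
  fix a b :: "('a, 'b) cobj" and f
  assume *: "a \<in> Obj (catC (compact_wrt c))" "b \<in> Obj (catC (compact_wrt c))"
    "f \<in> Hom (catC (compact_wrt c)) a b"
  obtain G I G' I' where eq: "a = (G, I)" "b = (G', I')" by (cases a, cases b)
  obtain h u \<phi> where f: "f = (h, u, \<phi>)" by (cases f)
  interpret catC_morphism c G I G' I' h u \<phi>
    using * by unfold_locales (simp_all add: eq f)
  show "brandt_mor a b f \<in> Hom (catK (compact_wrt c)) (brandt_obj a) (brandt_obj b)"
    unfolding eq f by (rule brandt_mor_hom)
next
  fix a b d :: "('a, 'b) cobj" and f g
  assume *: "a \<in> Obj (catC (compact_wrt c))" "b \<in> Obj (catC (compact_wrt c))"
      "d \<in> Obj (catC (compact_wrt c))"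
    "f \<in> Hom (catC (compact_wrt c)) a b" "g \<in> Hom (catC (compact_wrt c)) b d"
  obtain G I G' I' G'' I'' where eq: "a = (G, I)" "b = (G', I')" "d = (G'', I'')"
    by (cases a, cases b, cases d)
  obtain h u \<phi> h' u' \<phi>' where fg: "f = (h, u, \<phi>)" "g = (h', u', \<phi>')" by (cases f, cases g)
  interpret F: catC_morphism c G I G' I' h u \<phi>
    using * by unfold_locales (simp_all add: eq fg)
  interpret F': catC_morphism c G' I' G'' I'' h' u' \<phi>'
    using * by unfold_locales (simp_all add: eq fg)
  define w where "w = (\<lambda>\<alpha> \<in> I. u' (\<phi> \<alpha>) \<otimes>\<^bsub>G''\<^esub> h' (u \<alpha>))"
  have w_eq: "w i = u' (\<phi> i) \<otimes>\<^bsub>G''\<^esub> h' (u i)" if "i \<in> I" for i using that by (simp add: w_def)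
  have gf: "Comp (catC (compact_wrt c)) a b d g f = (compose (carrier G) h' h, w, compose I \<phi>' \<phi>)"
    by (simp add: eq fg catC_simps w_def)
  have "Comp (catC (compact_wrt c)) a b d g f \<in> Hom (catC (compact_wrt c)) a d"
    using is_category_catC[of "compact_wrt c"] * unfolding is_category_def by blast
  then have "(compose (carrier G) h' h, w, compose I \<phi>' \<phi>) \<in> Hom (catC (compact_wrt c)) (G, I) (G'', I'')"
    unfolding gf unfolding eq .
  then interpret FF: catC_morphism c G I G'' I'' "compose (carrier G) h' h" w "compose I \<phi>' \<phi>"
    using * by unfold_locales (simp_all only: eq)
  show "brandt_mor a d (Comp (catC (compact_wrt c)) a b d g f) =
      Comp (catK (compact_wrt c)) (brandt_obj a) (brandt_obj b) (brandt_obj d)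
        (brandt_mor b d g) (brandt_mor a b f)"
  proof
    fix x
    show "brandt_mor a d (Comp (catC (compact_wrt c)) a b d g f) x =
        Comp (catK (compact_wrt c)) (brandt_obj a) (brandt_obj b) (brandt_obj d)
          (brandt_mor b d g) (brandt_mor a b f) x"
    proof (cases "x \<in> brandt_carrier G I")
      case True
      then show ?thesis
        unfolding gf unfolding eq fg
        by (cases rule: F.G.brandt_carrier_cases)
          (simp_all add: catK_simps compose_eq w_eq F'.G'.m_assoc F'.G'.inv_mult_group)
    next
      case False
      then show ?thesis unfolding gf by (simp add: eq fg catK_simps compose_def brandt_mor_def)
    qed
  qed
qed

text \<open>On nonzero elements \<open>f\<close> is a functor of connected groupoids. It is
  determined by its effect on the units, on the vertex group at one index, and on one arrow joining
  each index to that one; these yield \<open>\<phi>\<close>, \<open>h\<close> and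
  \<open>u\<close>.\<close>

lemma is_full_brandt:
  "is_full (catC (compact_wrt c)) (catK (compact_wrt c)) brandt_obj brandt_mor"
  unfolding is_full_def
proof (intro ballI)
  fix a b :: "('a, 'b) cobj" and f
  assume a: "a \<in> Obj (catC (compact_wrt c))" and b: "b \<in> Obj (catC (compact_wrt c))"
    and f: "f \<in> Hom (catK (compact_wrt c)) (brandt_obj a) (brandt_obj b)"
  obtain G I G' I' where eq: "a = (G, I)" "b = (G', I')" by (cases a, cases b)
  interpret G: top_group G using a by unfold_locales (simp add: eq catC_simps)
  interpret G': top_group G' using b by unfold_locales (simp add: eq catC_simps)
  have zs: "zero_simple_inverse_semigroup (brandt_obj (G, I))"
    "zero_simple_inverse_semigroup (brandt_obj (G', I'))"
    using G.zero_simple_inverse_semigroup_brandt[of c I] G'.zero_simple_inverse_semigroup_brandt[of c I'] a b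
    by (simp_all add: eq catC_simps)
  have fhom: "f \<in> sg_hom (brandt_obj (G, I)) (brandt_obj (G', I'))"
    and fext: "f \<in> extensional (brandt_carrier G I)"
    and fcont: "continuous_map (brandt_topology G I) (brandt_topology G' I') f"
    and fnt: "\<not> trivial_hom (brandt_obj (G, I)) f"
    using f by (simp_all add: eq catK_simps)
  have fc: "f x \<in> brandt_carrier G' I'" if "x \<in> brandt_carrier G I" for x
    using fhom that by (auto simp: sg_hom_def)
  have fm: "f (brandt_mult G x y) = brandt_mult G' (f x) (f y)"
    if "x \<in> brandt_carrier G I" "y \<in> brandt_carrier G I" for x y
    using fhom that by (auto simp: sg_hom_def)
  have f0: "f x = None \<longleftrightarrow> x = None" if "x \<in> brandt_carrier G I" for x
    using nontrivial_hom_eq_zero_iff[OF zs fhom fnt, of x] that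
    by (simp add: G.brandt_zero_of G'.brandt_zero_of)
  have "\<exists>p \<in> I'. f (Some (i, \<one>\<^bsub>G\<^esub>, i)) = Some (p, \<one>\<^bsub>G'\<^esub>, p)" if i: "i \<in> I" for i
  proof -
    let ?x = "Some (i, \<one>\<^bsub>G\<^esub>, i)"
    have x: "?x \<in> brandt_carrier G I" using i by simp
    obtain p y q where y: "f ?x = Some (p, y, q)" "p \<in> I'" "y \<in> carrier G'" "q \<in> I'"
      using fc[OF x] f0[OF x] by (cases rule: G'.brandt_carrier_cases) auto
    \<comment> \<open>The image is a nonzero idempotent, and in a Brandt semigroup such an element
      has equal outer indices and middle coordinate \<open>\<one>\<close>.\<close>
    have "brandt_mult G' (f ?x) (f ?x) = f ?x" using fm[OF x x] by simp
    then have "q = p" "y \<otimes>\<^bsub>G'\<^esub> y = y" using y by (auto split: if_splits)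
    then have "y = \<one>\<^bsub>G'\<^esub>" using y by (simp add: G'.l_cancel_one)
    then show ?thesis using y \<open>q = p\<close> by auto
  qed
  then obtain \<phi> where \<phi>: "\<phi> i \<in> I'" "f (Some (i, \<one>\<^bsub>G\<^esub>, i)) = Some (\<phi> i, \<one>\<^bsub>G'\<^esub>, \<phi> i)" if "i \<in> I" for i
    by metis
  have \<phi>_inj: "i = k" if "i \<in> I" "k \<in> I" "\<phi> i = \<phi> k" for i k
  proof (rule ccontr)
    assume "i \<noteq> k"
    \<comment> \<open>Distinct units multiply to zero, whereas equal values of \<open>\<phi>\<close>
      would make the product of their images a nonzero unit.\<close>
    then have "f None = brandt_mult G' (f (Some (i, \<one>\<^bsub>G\<^esub>, i))) (f (Some (k, \<one>\<^bsub>G\<^esub>, k)))"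
      using fm[of "Some (i, \<one>\<^bsub>G\<^esub>, i)" "Some (k, \<one>\<^bsub>G\<^esub>, k)"] that by simp
    then show False using f0[of None] \<phi> that by simp
  qed
  \<comment> \<open>\<open>m i g k\<close> is the middle coordinate of the image; \<open>the\<close>
    is safe on the carrier because \<open>f\<close> sends only zero to zero.\<close>
  define m where "m i g k = fst (snd (the (f (Some (i, g, k)))))" for i g k
  have m: "f (Some (i, g, k)) = Some (\<phi> i, m i g k, \<phi> k)" "m i g k \<in> carrier G'"
    if ik: "i \<in> I" "g \<in> carrier G" "k \<in> I" for i g k
  proof -
    let ?x = "Some (i, g, k)"
    have x: "?x \<in> brandt_carrier G I" using ik by simp
    obtain p y q where y: "f ?x = Some (p, y, q)" "p \<in> I'" "y \<in> carrier G'" "q \<in> I'"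
      using fc[OF x] f0[OF x] by (cases rule: G'.brandt_carrier_cases) auto
    \<comment> \<open>Multiplication by the units at \<open>i\<close> and \<open>k\<close> on the
      two sides pins down the outer indices of the image.\<close>
    have "brandt_mult G' (f (Some (i, \<one>\<^bsub>G\<^esub>, i))) (f ?x) = f ?x"
      using fm[of "Some (i, \<one>\<^bsub>G\<^esub>, i)" ?x] ik by simp
    then have p: "\<phi> i = p" using ik y by (auto simp: \<phi> split: if_splits)
    have "brandt_mult G' (f ?x) (f (Some (k, \<one>\<^bsub>G\<^esub>, k))) = f ?x"
      using fm[of ?x "Some (k, \<one>\<^bsub>G\<^esub>, k)"] ik by simp
    then have "\<phi> k = q" using ik y by (auto simp: \<phi> split: if_splits)
    then show "f ?x = Some (\<phi> i, m i g k, \<phi> k)" "m i g k \<in> carrier G'"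
      using p y by (simp_all add: m_def)
  qed
  have m_mult: "m i (g \<otimes>\<^bsub>G\<^esub> g') l = m i g k \<otimes>\<^bsub>G'\<^esub> m k g' l"
    if "i \<in> I" "k \<in> I" "l \<in> I" "g \<in> carrier G" "g' \<in> carrier G" for i k l g g'
    using fm[of "Some (i, g, k)" "Some (k, g', l)"] that by (simp add: m)
  have m_one: "m i \<one>\<^bsub>G\<^esub> i = \<one>\<^bsub>G'\<^esub>" if "i \<in> I" for i
    using m(1)[of i "\<one>\<^bsub>G\<^esub>" i] \<phi>(2)[of i] that by simp
  \<comment> \<open>The base index \<open>i0\<close> is a choice: another one changes \<open>h\<close> by an inner automorphism of \<open>G'\<close> and \<open>u\<close> accordingly.\<close>
  obtain i0 where i0: "i0 \<in> I" using a by (auto simp: eq catC_simps)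
  define h where "h = (\<lambda>g \<in> carrier G. m i0 g i0)"
  define u where "u = (\<lambda>i \<in> I. m i \<one>\<^bsub>G\<^esub> i0)"
  have "h \<in> hom G G'" using i0 by (auto simp: hom_def h_def m intro!: m_mult)
  moreover have "continuous_map (gtop G) (gtop G') h"
    unfolding continuous_map_def
  proof (intro conjI allI impI)
    show "h \<in> topspace (gtop G) \<rightarrow> topspace (gtop G')" using i0 by (auto simp: h_def m)
    fix V assume V: "openin (gtop G') V"
    \<comment> \<open>The copy of \<open>V\<close> in a box is open in the Brandt space, so
      continuity of \<open>f\<close> passes to its middle coordinate.\<close>
    have "openin (brandt_topology G' I') ((\<lambda>g. Some (\<phi> i0, g, \<phi> i0)) ` V)"
      using V \<phi>(1) i0 by (intro G'.openin_box_image) auto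
    then have "openin (gtop G) {g \<in> topspace (gtop G). (f \<circ> (\<lambda>g. Some (i0, g, i0))) g \<in> (\<lambda>g. Some (\<phi> i0, g, \<phi> i0)) ` V}"
      by (rule openin_continuous_map_preimage[OF continuous_map_compose[OF G.continuous_box[OF i0 i0] fcont]])
    moreover have "{g \<in> topspace (gtop G). (f \<circ> (\<lambda>g. Some (i0, g, i0))) g \<in> (\<lambda>g. Some (\<phi> i0, g, \<phi> i0)) ` V} =
        {g \<in> topspace (gtop G). h g \<in> V}"
      using i0 by (auto simp: h_def m)
    ultimately show "openin (gtop G) {g \<in> topspace (gtop G). h g \<in> V}" by simp
  qed
  moreover have "u \<in> I \<rightarrow>\<^sub>E carrier G'" using i0 by (auto simp: u_def m)
  \<comment> \<open>Outside \<open>I\<close> the chosen \<open>\<phi>\<close> is arbitrary, while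
    components of morphisms are extensional.\<close>
  moreover have "restrict \<phi> I \<in> I \<rightarrow>\<^sub>E I'" "inj_on (restrict \<phi> I) I"
    using \<phi>(1) \<phi>_inj by (auto simp: inj_on_def)
  ultimately have hom: "(h, u, restrict \<phi> I) \<in> Hom (catC (compact_wrt c)) a b"
    by (simp add: eq catC_simps h_def)
  interpret F: catC_morphism c G I G' I' h u "restrict \<phi> I"
    using a b hom by unfold_locales (simp_all add: eq)
  \<comment> \<open>The triple \<open>(i, g, k)\<close> factors as \<open>(i, \<one>, i0)\<close>,
    \<open>(i0, g, i0)\<close>, \<open>(i0, \<one>, k)\<close>, and the image of the last factor has
    middle coordinate inverse to \<open>u k\<close>.\<close>
  have m_eq: "m i g k = u i \<otimes>\<^bsub>G'\<^esub> h g \<otimes>\<^bsub>G'\<^esub> inv\<^bsub>G'\<^esub> (u k)"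
    if ik: "i \<in> I" "g \<in> carrier G" "k \<in> I" for i g k
  proof -
    have "m i0 \<one>\<^bsub>G\<^esub> k \<otimes>\<^bsub>G'\<^esub> m k \<one>\<^bsub>G\<^esub> i0 = \<one>\<^bsub>G'\<^esub>"
      using m_mult[of i0 k i0 "\<one>\<^bsub>G\<^esub>" "\<one>\<^bsub>G\<^esub>"] m_one i0 ik by simp
    then have inv: "inv\<^bsub>G'\<^esub> (u k) = m i0 \<one>\<^bsub>G\<^esub> k"
      using G'.inv_equality m i0 ik by (simp add: u_def)
    have "m i g k = m i \<one>\<^bsub>G\<^esub> i0 \<otimes>\<^bsub>G'\<^esub> m i0 g i0 \<otimes>\<^bsub>G'\<^esub> m i0 \<one>\<^bsub>G\<^esub> k"
      using m_mult[of i i0 i0 "\<one>\<^bsub>G\<^esub>" g] m_mult[of i i0 k g "\<one>\<^bsub>G\<^esub>"] i0 ik by simp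
    moreover have "u i = m i \<one>\<^bsub>G\<^esub> i0" "h g = m i0 g i0" using ik by (simp_all add: u_def h_def)
    ultimately show ?thesis by (simp only: inv)
  qed
  have "f x = brandt_mor (G, I) (G', I') (h, u, restrict \<phi> I) x" if "x \<in> brandt_carrier G I" for x
    using that by (cases rule: G.brandt_carrier_cases) (auto simp: m m_eq f0)
  moreover have "f x = brandt_mor (G, I) (G', I') (h, u, restrict \<phi> I) x" if "x \<notin> brandt_carrier G I" for x
    using that fext by (simp add: brandt_mor_def extensional_def)
  ultimately have "f = brandt_mor a b (h, u, restrict \<phi> I)" unfolding eq by blast
  then show "\<exists>k\<in>Hom (catC (compact_wrt c)) a b. f = brandt_mor a b k" using hom by blast
qed

text \<open>Objects of the target live over triples from \<open>'u\<close> with a zero adjoined.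
  Injecting that larger type into \<open>'u\<close> places the group and the indices extracted from
  \<open>S\<close> where the source category has its objects.\<close>

lemma is_representative_brandt:
  assumes "infinite (UNIV :: 'u set)"
  shows "is_representative top_isomorphic
    (catC (compact_wrt c) :: (('u, 'u) cobj, ('u, 'u) cmor) cat)
    (catK (compact_wrt c) :: (('u \<times> 'u \<times> 'u) option top_semigroup, _) cat) brandt_obj"
  unfolding is_representative_def
proof
  fix S :: "('u \<times> 'u \<times> 'u) option top_semigroup"
  assume S: "S \<in> Obj (catK (compact_wrt c))"
  interpret zero_simple_inverse_semigroup S by (rule catK_objD[OF S])
  obtain j :: "('u \<times> 'u \<times> 'u) option \<Rightarrow> 'u" where j: "inj j"
    using infinite_universe_embedding[OF assms] .
  obtain G :: "'u top_group" and I :: "'u set" where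
    "is_top_group G" "compact_wrt c (gtop G)" "finite I" "I \<noteq> {}" "top_isomorphic S (brandt_obj (G, I))"
    using brandt_representation[OF _ j, of c] S by (auto simp: catK_simps)
  then show "\<exists>a \<in> Obj (catC (compact_wrt c) :: (('u, 'u) cobj, ('u, 'u) cmor) cat).
      top_isomorphic S (brandt_obj a)"
    by (intro bexI[of _ "(G, I)"]) (auto simp: catC_simps)
qed

theorem proposition5p15:
  assumes "infinite (UNIV :: 'u set)"
  shows "full_representative_functor
           (catC countably_compact_space :: (('u, 'u) cobj, ('u, 'u) cmor) cat)
           (catK countably_compact_space :: (('u \<times> 'u \<times> 'u) option top_semigroup, _) cat)
           brandt_obj brandt_mor
       \<and> full_representative_functor
           (catC compact_space :: (('u, 'u) cobj, ('u, 'u) cmor) cat)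
           (catK compact_space :: (('u \<times> 'u \<times> 'u) option top_semigroup, _) cat)
           brandt_obj brandt_mor"
  unfolding full_representative_functor_def compact_wrt_True[symmetric] compact_wrt_False[symmetric]
  using is_functor_brandt is_full_brandt is_representative_brandt[OF assms] by blast

end
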